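(* Let $f \in L^{\infty}(\mathbb{R})$ denote a function with $0 \leq f \leq 1$, and consider the model $$dS_0 = \rho\, S_0\, dt,\qquad S_0(0) = M\,(1-f(B(T))),$$ $$d^* S_1 = \mu\, S_1\, dt + \sigma\, S_1\, d^* B(t),\qquad S_1(0) = M f(B(T)),$$ on $[0,T]$, where $d^*$ denotes the Ayed-Kuo stochastic differential, and set $M^{(\mathrm{AK})}(T) := S_0(T)+S_1(T)$. The optimal investment strategy, i.e. the function $f \in L^\infty(\mathbb{R})$ with $0\le f\le 1$ that maximizes $\mathbb{E}\left[M^{(\mathrm{AK})}(T)\right]$ among all such functions, is $$ f(B(T)) = 1.$$
   Context: $\{B(t), t\ge 0\}$ is a standard one-dimensional Brownian motion and $\{\mathcal{F}_t, t\ge 0\}$ is a filtration such that $B(t)$ is $\mathcal{F}_t$-measurable for all $t\ge 0$ and $B(t)-B(s)$ is independent of $\mathcal{F}_s$ for all $0\le s<t$. $T>0$ is a fixed time horizon, and $M,\rho,\mu,\sigma$ are positive constants with $\mu>\rho$ ($M$ is the total initial wealth, $\rho$ the interest rate of the bank account, $\mu$ and $\sigma$ the appreciation rate and the volatility of the stock). Functions in $L^\infty(\mathbb{R})$ are identified when equal Lebesgue-almost everywhere. Instant independence: a process $\{\varphi(t), t\in[a,b]\}$ is instantly independent with respect to $\{\mathcal{F}_t\}$ if $\varphi(t)$ is independent of $\mathcal{F}_t$ for each $t\in[a,b]$. Ayed-Kuo integral, first step: for an $\{\mathcal{F}_t\}$-adapted process $g$ and an instantly independent process $\varphi$, $$\int_a^b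 g(t)\varphi(t)\,d^*B(t) := \lim_{|\Pi_n|\to 0}\sum_{i=1}^n g(t_{i-1})\varphi(t_i)\,(B(t_i)-B(t_{i-1})),$$ provided the limit in probability exists, where $\Pi_n=\{a=t_0,t_1,\dots,t_n=b\}$ is a partition of $[a,b]$ and $|\Pi_n|=\max_{1\le i\le n}(t_i-t_{i-1})$. The integral is extended by linearity to finite sums of such products (this is known to be consistent). Ayed-Kuo integral, extension: let $\Phi_n$, $n\ge1$, be processes each of which is a finite sum $\Phi_n(t)=\sum_{i=1}^k g_i(t)\varphi_i(t)$, $a\le t\le b$, with $g_i$ continuous $\{\mathcal{F}_t\}$-adapted and $\varphi_i$ continuous and instantly independent of $\{\mathcal{F}_t\}$ (with $k$, $g_i$, $\varphi_i$ depending on $n$). If $\Phi$ is a process such that (a) $\int_a^b|\Phi(t)-\Phi_n(t)|^2dt\to0$ almost surely and (b) $\int_a^b\Phi_n(t)\,d^*B(t)$ converges in probability as $n\to\infty$, then $\Phi$ is Ayed-Kuo integrable and $\int_a^b\Phi(t)\,d^*B(t):=\lim_{n\to\infty}\int_a^b\Phi_n(t)\,d^*B(t)$ in probability. The equation for $S_0$ is an ordinary differential equation with random initial condition, solved pathwise. The equation for $S_1$ means $S_1(t)=S_1(0)+\mu\int_0^tS_1(s)\,ds+\sigma\int_0^tS_1(s)\,d^*B(s)$ with the extended Ayed-Kuo integral; $S_1$ denotes the unique solution of this initial value problem. *)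

theory Defs
  imports "HOL-Probability.Probability"
begin

section \<open>Brownian motion and its filtration\<close>

definition sigma_of :: "'a measure \<Rightarrow> ('a \<Rightarrow> real) \<Rightarrow> 'a set set" where
  "sigma_of P X = {X -` A \<inter> space P | A. A \<in> sets borel}"

definition standard_brownian_motion :: "'a measure \<Rightarrow> (real \<Rightarrow> 'a \<Rightarrow> real) \<Rightarrow> bool" where
  "standard_brownian_motion P B \<longleftrightarrow>
     prob_space P \<and>
     (\<forall>t\<ge>0. B t \<in> borel_measurable P) \<and>
     (AE \<omega> in P. B 0 \<omega> = 0) \<and>
     (AE \<omega> in P. continuous_on {0..} (\<lambda>t. B t \<omega>)) \<and>
     (\<forall>s t. 0 \<le> s \<and> s < t \<longrightarrow>
        distributed P lborel (\<lambda>\<omega>. B t \<omega> - B s \<omega>) (normal_density 0 (sqrt (t - s)))) \<and>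
     (\<forall>n (u :: nat \<Rightarrow> real). 0 \<le> u 0 \<and> strict_mono u \<longrightarrow>
        prob_space.indep_vars P (\<lambda>_. borel) (\<lambda>i \<omega>. B (u (Suc i)) \<omega> - B (u i) \<omega>) {..<n})"

text \<open>Only the values \<^term>\<open>F t\<close> with \<^prop>\<open>t \<ge> 0\<close> matter.\<close>

definition brownian_filtration ::
    "'a measure \<Rightarrow> (real \<Rightarrow> 'a measure) \<Rightarrow> (real \<Rightarrow> 'a \<Rightarrow> real) \<Rightarrow> bool" where
  "brownian_filtration P F B \<longleftrightarrow>
     (\<forall>t\<ge>0. subalgebra P (F t)) \<and>
     (\<forall>s t. 0 \<le> s \<and> s \<le> t \<longrightarrow> subalgebra (F t) (F s)) \<and>
     (\<forall>t\<ge>0. B t \<in> borel_measurable (F t)) \<and>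
     (\<forall>s t. 0 \<le> s \<and> s < t \<longrightarrow>
        prob_space.indep_set P (sets (F s)) (sigma_of P (\<lambda>\<omega>. B t \<omega> - B s \<omega>)))"

section \<open>The Ayed-Kuo integral\<close>

definition tendsto_in_prob ::
    "'a measure \<Rightarrow> ('i \<Rightarrow> 'a \<Rightarrow> real) \<Rightarrow> ('a \<Rightarrow> real) \<Rightarrow> 'i filter \<Rightarrow> bool" where
  "tendsto_in_prob P X Y G \<longleftrightarrow>
     Y \<in> borel_measurable P \<and>
     (\<forall>\<epsilon>>0. ((\<lambda>i. measure P {\<omega> \<in> space P. \<bar>X i \<omega> - Y \<omega>\<bar> > \<epsilon>}) \<longlongrightarrow> 0) G)"

definition is_partition :: "real \<Rightarrow> real \<Rightarrow> real list \<Rightarrow> bool" where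
  "is_partition a b ts \<longleftrightarrow> ts \<noteq> [] \<and> hd ts = a \<and> last ts = b \<and> sorted_wrt (<) ts"

text \<open>The filter expressing that the mesh of a partition of \<open>[a, b]\<close> tends to zero.
  For \<open>a = b\<close> the only partition is \<open>[a]\<close>, whose Riemann sums are empty.\<close>

definition mesh_to_0 :: "real \<Rightarrow> real \<Rightarrow> real list filter" where
  "mesh_to_0 a b =
     (INF \<delta>\<in>{0<..}. principal {ts. is_partition a b ts \<and>
        (\<forall>i < length ts - 1. ts ! Suc i - ts ! i < \<delta>)})"

definition adapted_on ::
    "(real \<Rightarrow> 'a measure) \<Rightarrow> real \<Rightarrow> real \<Rightarrow> (real \<Rightarrow> 'a \<Rightarrow> real) \<Rightarrow> bool" where
  "adapted_on F a b g \<longleftrightarrow> (\<forall>t\<in>{a..b}. g t \<in> borel_measurable (F t))"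

definition instantly_independent_on ::
    "'a measure \<Rightarrow> (real \<Rightarrow> 'a measure) \<Rightarrow> real \<Rightarrow> real \<Rightarrow> (real \<Rightarrow> 'a \<Rightarrow> real) \<Rightarrow> bool" where
  "instantly_independent_on P F a b \<phi> \<longleftrightarrow>
     (\<forall>t\<in>{a..b}. \<phi> t \<in> borel_measurable P \<and>
        prob_space.indep_set P (sets (F t)) (sigma_of P (\<phi> t)))"

definition continuous_process_on ::
    "'a measure \<Rightarrow> real \<Rightarrow> real \<Rightarrow> (real \<Rightarrow> 'a \<Rightarrow> real) \<Rightarrow> bool" where
  "continuous_process_on P a b X \<longleftrightarrow> (AE \<omega> in P. continuous_on {a..b} (\<lambda>t. X t \<omega>))"

definition AK_riemann_sum ::
    "(real \<Rightarrow> 'a \<Rightarrow> real) \<Rightarrow> (real \<Rightarrow> 'a \<Rightarrow> real) \<Rightarrow> (real \<Rightarrow> 'a \<Rightarrow> real)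
      \<Rightarrow> real list \<Rightarrow> 'a \<Rightarrow> real" where
  "AK_riemann_sum B g \<phi> ts \<omega> =
     (\<Sum>i < length ts - 1. g (ts ! i) \<omega> * \<phi> (ts ! Suc i) \<omega> * (B (ts ! Suc i) \<omega> - B (ts ! i) \<omega>))"

definition has_AK_product_integral ::
    "'a measure \<Rightarrow> (real \<Rightarrow> 'a measure) \<Rightarrow> (real \<Rightarrow> 'a \<Rightarrow> real) \<Rightarrow> real \<Rightarrow> real
      \<Rightarrow> (real \<Rightarrow> 'a \<Rightarrow> real) \<Rightarrow> (real \<Rightarrow> 'a \<Rightarrow> real) \<Rightarrow> ('a \<Rightarrow> real) \<Rightarrow> bool" where
  "has_AK_product_integral P F B a b g \<phi> I \<longleftrightarrow>
     adapted_on F a b g \<and> instantly_independent_on P F a b \<phi> \<and>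
     tendsto_in_prob P (AK_riemann_sum B g \<phi>) I (mesh_to_0 a b)"

text \<open>A finite sum of products is given by the list of its pairs \<open>(g, \<phi>)\<close>.\<close>

type_synonym 'a product_sum = "((real \<Rightarrow> 'a \<Rightarrow> real) \<times> (real \<Rightarrow> 'a \<Rightarrow> real)) list"

definition product_sum_process :: "'a product_sum \<Rightarrow> real \<Rightarrow> 'a \<Rightarrow> real" where
  "product_sum_process ps t \<omega> = (\<Sum>(g, \<phi>)\<leftarrow>ps. g t \<omega> * \<phi> t \<omega>)"

definition has_AK_sum_integral ::
    "'a measure \<Rightarrow> (real \<Rightarrow> 'a measure) \<Rightarrow> (real \<Rightarrow> 'a \<Rightarrow> real) \<Rightarrow> real \<Rightarrow> real
      \<Rightarrow> 'a product_sum \<Rightarrow> ('a \<Rightarrow> real) \<Rightarrow> bool" where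
  "has_AK_sum_integral P F B a b ps I \<longleftrightarrow>
     (\<exists>Is. list_all2 (\<lambda>(g, \<phi>) J. has_AK_product_integral P F B a b g \<phi> J) ps Is \<and>
           I = (\<lambda>\<omega>. \<Sum>J\<leftarrow>Is. J \<omega>))"

definition admissible_product_sum ::
    "'a measure \<Rightarrow> (real \<Rightarrow> 'a measure) \<Rightarrow> real \<Rightarrow> real \<Rightarrow> 'a product_sum \<Rightarrow> bool" where
  "admissible_product_sum P F a b ps \<longleftrightarrow>
     (\<forall>(g, \<phi>) \<in> set ps.
        adapted_on F a b g \<and> continuous_process_on P a b g \<and>
        instantly_independent_on P F a b \<phi> \<and> continuous_process_on P a b \<phi>)"

text \<open>The extended integral is a relation, not a function: nothing in its definition forces the
  limit to be independent of the approximating sequence \<open>ps\<close>. For example, let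
  \<open>F\<^sub>n\<close> be trigonometric polynomials with \<open>F\<^sub>n \<rightarrow> 0\<close> uniformly and
  \<open>F\<^sub>n' \<rightarrow> 1\<close> in measure (smoothed sawtooths). The constant-in-time processes
  \<open>F\<^sub>n (B b)\<close> approximate the process \<open>0\<close>, while their integrals
  \<open>F\<^sub>n (B b) (B b - B a) - F\<^sub>n' (B b) (b - a)\<close> tend to \<open>-(b - a)\<close>.\<close>

definition has_AK_integral ::
    "'a measure \<Rightarrow> (real \<Rightarrow> 'a measure) \<Rightarrow> (real \<Rightarrow> 'a \<Rightarrow> real) \<Rightarrow> real \<Rightarrow> real
      \<Rightarrow> (real \<Rightarrow> 'a \<Rightarrow> real) \<Rightarrow> ('a \<Rightarrow> real) \<Rightarrow> bool" where
  "has_AK_integral P F B a b \<Phi> I \<longleftrightarrow>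
     (\<forall>t\<in>{a..b}. \<Phi> t \<in> borel_measurable P) \<and>
     (AE \<omega> in P. set_borel_measurable borel {a..b} (\<lambda>t. \<Phi> t \<omega>)) \<and>
     (\<exists>(ps :: nat \<Rightarrow> 'a product_sum) J.
        (\<forall>n. admissible_product_sum P F a b (ps n) \<and> has_AK_sum_integral P F B a b (ps n) (J n)) \<and>
        (AE \<omega> in P.
           (\<forall>n. set_integrable lborel {a..b} (\<lambda>t. \<bar>\<Phi> t \<omega> - product_sum_process (ps n) t \<omega>\<bar>\<^sup>2)) \<and>
           (\<lambda>n. LBINT t:{a..b}. \<bar>\<Phi> t \<omega> - product_sum_process (ps n) t \<omega>\<bar>\<^sup>2) \<longlonglongrightarrow> 0) \<and>
        tendsto_in_prob P J I sequentially)"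

section \<open>The market model\<close>

text \<open>An element of \<open>L\<^sup>\<infinity>\<close> is given by a Borel representative (every class has one), so that
  \<open>f (B T)\<close> is a random variable; the bounds are imposed almost everywhere.\<close>

definition strategy :: "(real \<Rightarrow> real) \<Rightarrow> bool" where
  "strategy f \<longleftrightarrow> f \<in> borel_measurable borel \<and> (AE x in lborel. 0 \<le> f x \<and> f x \<le> 1)"

definition bank_solution ::
    "'a measure \<Rightarrow> (real \<Rightarrow> 'a \<Rightarrow> real) \<Rightarrow> real \<Rightarrow> real \<Rightarrow> real \<Rightarrow> (real \<Rightarrow> real)
      \<Rightarrow> (real \<Rightarrow> 'a \<Rightarrow> real) \<Rightarrow> bool" where
  "bank_solution P B T M \<rho> f X \<longleftrightarrow>
     (\<forall>\<omega>\<in>space P.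
        X 0 \<omega> = M * (1 - f (B T \<omega>)) \<and>
        (\<forall>t\<in>{0..T}. ((\<lambda>s. X s \<omega>) has_real_derivative \<rho> * X t \<omega>) (at t within {0..T})))"

definition AK_stock_solution ::
    "'a measure \<Rightarrow> (real \<Rightarrow> 'a measure) \<Rightarrow> (real \<Rightarrow> 'a \<Rightarrow> real) \<Rightarrow> real \<Rightarrow> real \<Rightarrow> real \<Rightarrow> real
      \<Rightarrow> (real \<Rightarrow> real) \<Rightarrow> (real \<Rightarrow> 'a \<Rightarrow> real) \<Rightarrow> bool" where
  "AK_stock_solution P F B T M \<mu> \<sigma> f X \<longleftrightarrow>
     (\<forall>t\<in>{0..T}. X t \<in> borel_measurable P) \<and>
     (AE \<omega> in P. set_integrable lborel {0..T} (\<lambda>s. X s \<omega>)) \<and>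
     (AE \<omega> in P. X 0 \<omega> = M * f (B T \<omega>)) \<and>
     (\<forall>t\<in>{0..T}. \<exists>I. has_AK_integral P F B 0 t X I \<and>
        (AE \<omega> in P. X t \<omega> = X 0 \<omega> + \<mu> * (LBINT s:{0..t}. X s \<omega>) + \<sigma> * I \<omega>))"

definition unique_AK_stock_solution ::
    "'a measure \<Rightarrow> (real \<Rightarrow> 'a measure) \<Rightarrow> (real \<Rightarrow> 'a \<Rightarrow> real) \<Rightarrow> real \<Rightarrow> real \<Rightarrow> real \<Rightarrow> real
      \<Rightarrow> (real \<Rightarrow> real) \<Rightarrow> (real \<Rightarrow> 'a \<Rightarrow> real) \<Rightarrow> bool" where
  "unique_AK_stock_solution P F B T M \<mu> \<sigma> f X \<longleftrightarrow>
     AK_stock_solution P F B T M \<mu> \<sigma> f X \<and>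
     (\<forall>Y. AK_stock_solution P F B T M \<mu> \<sigma> f Y \<longrightarrow> (\<forall>t\<in>{0..T}. AE \<omega> in P. Y t \<omega> = X t \<omega>))"

text \<open>The standard closed-form solution. Because the extended integral is multivalued, solutions
  in the sense of \<^const>\<open>AK_stock_solution\<close> need not be unique, and a theorem that only speaks
  about unique solutions could be void. It is therefore accompanied by the same assertion for
  this process, including the claim that it does solve the equation.\<close>

definition AK_stock ::
    "(real \<Rightarrow> 'a \<Rightarrow> real) \<Rightarrow> real \<Rightarrow> real \<Rightarrow> real \<Rightarrow> real \<Rightarrow> (real \<Rightarrow> real) \<Rightarrow> real \<Rightarrow> 'a \<Rightarrow> real" where
  "AK_stock B T M \<mu> \<sigma> f t \<omega> =
     M * f (B T \<omega> - \<sigma> * t) * exp ((\<mu> - \<sigma>\<^sup>2 / 2) * t + \<sigma> * B t \<omega>)"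

text \<open>\<^term>\<open>W h\<close> is the terminal wealth under the strategy \<^term>\<open>h\<close>. Integrability is part of the
  notion because the Bochner integral of a non-integrable function is \<open>0\<close> by convention.\<close>

definition optimal_strategy ::
    "'a measure \<Rightarrow> ((real \<Rightarrow> real) \<Rightarrow> 'a \<Rightarrow> real) \<Rightarrow> (real \<Rightarrow> real) \<Rightarrow> bool" where
  "optimal_strategy P W f \<longleftrightarrow>
     strategy f \<and> integrable P (W f) \<and>
     (\<forall>h. strategy h \<longrightarrow> integrable P (W h) \<and>
        prob_space.expectation P (W h) \<le> prob_space.expectation P (W f))"

end

theory Submission
  imports Defs
begin

text \<open>
  For \<open>f x = exp (\<kappa> x)\<close> the process \<^const>\<open>AK_stock\<close> is a product of an adapted factor and the
  instantly independent factor \<open>exp (\<kappa> (B T - B s))\<close>. In its Riemann sums \<open>exp (\<kappa> B T)\<close> factors out,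
  and what remains, \<open>\<Sum> Z\<^sub>i exp (-\<kappa> \<Delta>B\<^sub>i) \<Delta>B\<^sub>i\<close> with \<open>Z\<close> a geometric Brownian motion, converges by a
  second-order Taylor expansion and the law of the quadratic variation. A general \<open>f\<close> is the limit
  almost everywhere of locally bounded polynomials in \<open>exp x\<close>; the integral equation itself then
  shows that the approximating integrals converge.

  By the Girsanov shift the expected terminal wealth equals
  \<open>M exp (\<rho> T) + M (exp (\<mu> T) - exp (\<rho> T)) E (f (B T))\<close>, an increasing function of \<open>E (f (B T))\<close>.
\<close>

section \<open>Partitions and pathwise Ito expansion\<close>

text \<open>The shift \<open>\<sigma> * t\<close> in \<open>AK_stock\<close> is the correction for
  anticipation. The sums evaluate the future factor at the right endpoint, so each summand carries
  exp(-\<kappa> \<Delta>B), whose effect -\<kappa> (\<Delta>B)^2 adds up to a drift of rate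
  -\<sigma> \<kappa>. The factor exp(-\<sigma> \<kappa> t) that accounts for it is what translation
  by \<sigma> t does to exp(\<kappa> x). The rule has the same form for every \<kappa>, so it passes
  through linear combinations and limits to any f as a translation of the argument.

  The factor exp(\<kappa> B T) and exponential polynomials of growing degree would spoil moment
  estimates. In the construction of the integrals moments are therefore used only for the quadratic
  variation with bounded weights; from there limits are taken path by path and only at the end
  turned into convergence in probability.

  As the extended integral is a relation, no uniqueness of solutions is proved. Existence suffices:
  a solution that is assumed unique must agree with \<open>AK_stock\<close>.\<close>

lemma eventually_mesh_to_0:
  "eventually Q (mesh_to_0 a b) \<longleftrightarrow>
     (\<exists>\<delta>>0. \<forall>ts. is_partition a b ts \<longrightarrow> (\<forall>i<length ts - 1. ts ! Suc i - ts ! i < \<delta>) \<longrightarrow> Q ts)"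
proof -
  let ?A = "\<lambda>\<delta>. {ts. is_partition a b ts \<and> (\<forall>i < length ts - 1. ts ! Suc i - ts ! i < \<delta>)}"
  have "eventually Q (mesh_to_0 a b) \<longleftrightarrow> (\<exists>\<delta>\<in>{0<..}. eventually Q (principal (?A \<delta>)))"
    unfolding mesh_to_0_def
  proof (rule eventually_INF_base)
    fix c d :: real assume "c \<in> {0<..}" "d \<in> {0<..}"
    then show "\<exists>x\<in>{0<..}. principal (?A x) \<le> inf (principal (?A c)) (principal (?A d))"
      by (intro bexI[of _ "min c d"]) auto
  qed auto
  then show ?thesis
    by (auto simp: eventually_principal Bex_def)
qed

lemma eventually_is_partition: "eventually (is_partition a b) (mesh_to_0 a b)"
  unfolding eventually_mesh_to_0 by (rule exI[of _ 1]) simp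

lemma is_partition_first: "is_partition a b ts \<Longrightarrow> ts ! 0 = a"
  by (auto simp: is_partition_def hd_conv_nth)

lemma is_partition_last: "is_partition a b ts \<Longrightarrow> ts ! (length ts - 1) = b"
  by (auto simp: is_partition_def last_conv_nth)

lemma is_partition_less:
  "is_partition a b ts \<Longrightarrow> i < length ts - 1 \<Longrightarrow> ts ! i < ts ! Suc i"
  by (auto simp: is_partition_def sorted_wrt_iff_nth_less)

lemma is_partition_mem:
  assumes "is_partition a b ts" "i \<le> length ts - 1"
  shows "ts ! i \<in> {a..b}"
proof -
  have *: "ts ! j \<le> ts ! k" if "j \<le> k" "k \<le> length ts - 1" for j k
  proof (cases "j = k")
    case False
    have "ts \<noteq> []" using assms by (auto simp: is_partition_def)
    then have "k < length ts" using that by (cases ts) auto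
    then show ?thesis using assms False that
      by (auto simp: is_partition_def sorted_wrt_iff_nth_less less_imp_le)
  qed simp
  show ?thesis
    using *[of 0 i] *[of i "length ts - 1"] assms is_partition_first[OF assms(1)]
      is_partition_last[OF assms(1)] by auto
qed

lemma is_partition_telescope:
  fixes v :: "real \<Rightarrow> real"
  assumes "is_partition a b ts"
  shows "(\<Sum>i<length ts - 1. v (ts ! Suc i) - v (ts ! i)) = v b - v a"
  using sum_lessThan_telescope[of "\<lambda>i. v (ts ! i)" "length ts - 1"]
    is_partition_first[OF assms] is_partition_last[OF assms] by simp

text \<open>For comparing Riemann sums with the integral: uniform continuity controls the difference
  of two values of \<open>z\<close> within one cell, so the cell integral is wanted as such a value
  times the length.\<close>

lemma mvt_integral:
  fixes z :: "real \<Rightarrow> real"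
  assumes z: "continuous_on {a..b} z" and uv: "a \<le> u" "u < v" "v \<le> b"
  shows "\<exists>\<xi>\<in>{u..v}. integral {a..v} z - integral {a..u} z = (v - u) * z \<xi>"
proof -
  let ?G = "\<lambda>s. integral {a..s} z"
  have D: "(?G has_real_derivative z s) (at s within {a..b})" if "s \<in> {a..b}" for s
    using integral_has_real_derivative[OF z that] .
  have D': "(?G has_real_derivative z s) (at s)" if "u < s" "s < v" for s
  proof -
    have "(?G has_real_derivative z s) (at s within {a<..<b})"
      using D[of s] that uv by (auto intro: DERIV_subset)
    then show ?thesis using that uv by (subst (asm) at_within_open) auto
  qed
  have "continuous_on {a..b} ?G"
    using D DERIV_continuous_on by blast
  then have "continuous_on {u..v} ?G"
    using uv by (auto intro: continuous_on_subset)
  then obtain l \<xi> where "u < \<xi>" "\<xi> < v" "(?G has_real_derivative l) (at \<xi>)" "?G v - ?G u = (v - u) * l"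
    using MVT[OF uv(2), of ?G] D' real_differentiable_def by blast
  moreover from this have "l = z \<xi>" using D' DERIV_unique by blast
  ultimately show ?thesis by (intro bexI[of _ \<xi>]) auto
qed

lemma riemann_sums_tendsto:
  fixes z :: "real \<Rightarrow> real"
  assumes z: "continuous_on {a..b} z"
  shows "((\<lambda>ts. \<Sum>i<length ts - 1. z (ts ! i) * (ts ! Suc i - ts ! i))
            \<longlongrightarrow> (LBINT s:{a..b}. z s)) (mesh_to_0 a b)"
proof (rule tendstoI)
  fix \<epsilon> :: real assume \<epsilon>: "\<epsilon> > 0"
  \<comment> \<open>The \<open>+ 1\<close> keeps the quotient defined and the final inequality
    strict when a = b.\<close>
  define \<eta> where "\<eta> = \<epsilon> / (\<bar>b - a\<bar> + 1)"
  have \<eta>: "\<eta> > 0" using \<epsilon> by (simp add: \<eta>_def)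
  have "uniformly_continuous_on {a..b} z"
    using z compact_uniformly_continuous by blast
  then obtain \<delta> where \<delta>: "\<delta> > 0"
    and uc: "\<And>x y. x \<in> {a..b} \<Longrightarrow> y \<in> {a..b} \<Longrightarrow> dist y x < \<delta> \<Longrightarrow> dist (z y) (z x) < \<eta>"
    using \<eta> unfolding uniformly_continuous_on_def by metis
  have eq: "(LBINT s:{a..b}. z s) = integral {a..b} z"
    by (rule set_borel_integral_eq_integral(2)[OF borel_integrable_atLeastAtMost'[OF z]])
  show "eventually (\<lambda>ts. dist (\<Sum>i<length ts - 1. z (ts ! i) * (ts ! Suc i - ts ! i))
          (LBINT s:{a..b}. z s) < \<epsilon>) (mesh_to_0 a b)"
    unfolding eventually_mesh_to_0
  proof (intro exI conjI allI impI)
    fix ts assume p: "is_partition a b ts" and m: "\<forall>i<length ts - 1. ts ! Suc i - ts ! i < \<delta>"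
    let ?N = "length ts - 1"
    have ab: "a \<le> b" using is_partition_mem[OF p, of 0] by simp
    let ?G = "\<lambda>s. integral {a..s} z"
    have "(\<Sum>i<?N. z (ts ! i) * (ts ! Suc i - ts ! i)) - integral {a..b} z
        = (\<Sum>i<?N. z (ts ! i) * (ts ! Suc i - ts ! i) - (?G (ts ! Suc i) - ?G (ts ! i)))"
      using is_partition_telescope[OF p, of ?G] by (simp add: sum_subtractf)
    also have "\<bar>\<dots>\<bar> \<le> (\<Sum>i<?N. \<eta> * (ts ! Suc i - ts ! i))"
    proof (rule order_trans[OF sum_abs sum_mono])
      fix i assume "i \<in> {..<?N}"
      then have i: "i < ?N" by simp
      have u: "ts ! i \<in> {a..b}" "ts ! Suc i \<in> {a..b}" "ts ! i < ts ! Suc i"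
        using is_partition_mem[OF p] is_partition_less[OF p i] i by auto
      obtain \<xi> where \<xi>: "\<xi> \<in> {ts ! i..ts ! Suc i}"
        "?G (ts ! Suc i) - ?G (ts ! i) = (ts ! Suc i - ts ! i) * z \<xi>"
        using mvt_integral[OF z, of "ts ! i" "ts ! Suc i"] u by auto
      have "ts ! Suc i - ts ! i < \<delta>" using m i by blast
      then have "dist (z (ts ! i)) (z \<xi>) < \<eta>"
        using \<xi>(1) u by (intro uc) (auto simp: dist_real_def)
      moreover have "z (ts ! i) * (ts ! Suc i - ts ! i) - (?G (ts ! Suc i) - ?G (ts ! i))
          = (z (ts ! i) - z \<xi>) * (ts ! Suc i - ts ! i)"
        by (simp add: \<xi>(2) algebra_simps)
      ultimately show "\<bar>z (ts ! i) * (ts ! Suc i - ts ! i) - (?G (ts ! Suc i) - ?G (ts ! i))\<bar>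
          \<le> \<eta> * (ts ! Suc i - ts ! i)"
        using u(3) by (auto simp: dist_real_def abs_mult intro!: mult_mono)
    qed
    also have "\<dots> = \<eta> * (b - a)"
      using is_partition_telescope[OF p, of "\<lambda>s. s"] by (simp add: sum_distrib_left[symmetric])
    also have "\<dots> < \<epsilon>"
      using \<epsilon> ab by (simp add: \<eta>_def divide_simps algebra_simps)
    finally show "dist (\<Sum>i<?N. z (ts ! i) * (ts ! Suc i - ts ! i)) (LBINT s:{a..b}. z s) < \<epsilon>"
      by (simp add: eq dist_real_def)
  qed (use \<delta> in auto)
qed

section \<open>Second-order expansion of the exponential\<close>

lemma exp_taylor1: "\<bar>y\<bar> \<le> 1 \<Longrightarrow> \<bar>exp y - 1 - y\<bar> \<le> 3 * y\<^sup>2" for y :: real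
proof -
  assume y: "\<bar>y\<bar> \<le> 1"
  have "norm (exp y - (\<Sum>k\<le>1. y ^ k / fact k)) \<le> exp \<bar>y\<bar> * (norm y ^ Suc 1) / fact 1"
    using Taylor_exp_field[of y 1] by (simp add: divide_inverse)
  moreover have "exp \<bar>y\<bar> \<le> 3" using exp_le y by (meson exp_le_cancel_iff order_trans)
  then have "exp \<bar>y\<bar> * (norm y ^ Suc 1) \<le> 3 * (norm y ^ Suc 1)"
    by (intro mult_right_mono) auto
  ultimately show ?thesis
    by (simp add: power2_eq_square diff_diff_eq)
qed

text \<open>The 3 bounds exp(1) in the Taylor remainder. The cubic term is kept as
  \<open>\<bar>y\<bar> * y\<^sup>2\<close> so that one factor can be made small while the square
  survives as part of a quadratic variation.\<close>

lemma exp_taylor2: "\<bar>y\<bar> \<le> 1 \<Longrightarrow> \<bar>exp y - 1 - y - y\<^sup>2 / 2\<bar> \<le> 3 * (\<bar>y\<bar> * y\<^sup>2)" for y :: real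
proof -
  assume y: "\<bar>y\<bar> \<le> 1"
  have T: "norm (exp y - (\<Sum>k\<le>2. y ^ k / fact k)) \<le> exp (norm y) * (norm y ^ Suc 2) / fact 2"
    by (rule Taylor_exp_field)
  have "(\<Sum>k\<le>2. y ^ k / fact k) = 1 + y + y\<^sup>2 / 2"
    by (simp add: eval_nat_numeral)
  moreover have "exp (norm y) * (norm y ^ Suc 2) / fact 2 \<le> exp (norm y) * (norm y ^ Suc 2)"
    by (simp add: divide_le_eq)
  moreover have "exp (norm y) \<le> 3" using exp_le y by (simp, meson exp_le_cancel_iff order_trans)
  then have "exp (norm y) * (norm y ^ Suc 2) \<le> 3 * (norm y ^ Suc 2)"
    by (rule mult_right_mono) simp
  moreover have "norm y ^ Suc 2 = \<bar>y\<bar> * y\<^sup>2"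
    by (simp only: power_Suc real_norm_def power2_abs)
  ultimately show ?thesis
    using T by (simp only: real_norm_def) linarith
qed

text \<open>Ito's formula for a single cell, with x in the role of \<Delta>B and h of \<Delta>t.
  Terms of type x^3, x h and h^2 are negligible against x^2 + h. The coefficient of x^2 has two
  sources: \<sigma>^2/2 from the square in the exponential, and \<sigma> \<kappa> from expanding
  exp(-\<kappa> x) in the subtracted term. No relation between x^2 and h is used, so the estimate is
  deterministic.\<close>

lemma ito_expansion:
  fixes \<sigma> b \<kappa> :: real
  assumes \<eta>: "\<eta> > 0"
  shows "\<exists>\<delta>>0. \<forall>x h. \<bar>x\<bar> < \<delta> \<longrightarrow> 0 \<le> h \<longrightarrow> h < \<delta> \<longrightarrow>
     \<bar>exp (\<sigma> * x + b * h) - 1 - \<sigma> * x * exp (- \<kappa> * x) - b * h - (\<sigma>\<^sup>2 / 2 + \<sigma> * \<kappa>) * x\<^sup>2\<bar>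
       \<le> \<eta> * (x\<^sup>2 + h)"
proof -
  \<comment> \<open>One constant above all coefficients; S \<ge> 1 lets every product of up to three
    of them be bounded by S^3. The condition S \<delta> \<le> 1 gives access to the Taylor bounds.
    The errors add up to at most 9 S^3 \<delta> (x^2 + h), so 20 leaves slack.\<close>
  define S where "S = \<bar>\<sigma>\<bar> + \<bar>b\<bar> + \<bar>\<kappa>\<bar> + 1"
  have S: "S \<ge> 1" "\<bar>\<sigma>\<bar> \<le> S" "\<bar>b\<bar> \<le> S" "\<bar>\<kappa>\<bar> \<le> S" "\<bar>\<sigma>\<bar> + \<bar>b\<bar> \<le> S" by (auto simp: S_def)
  define \<delta> where "\<delta> = min (1 / S) (\<eta> / (20 * S ^ 3))"
  have \<delta>: "\<delta> > 0" "S * \<delta> \<le> 1" "20 * S ^ 3 * \<delta> \<le> \<eta>"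
  proof -
    show "\<delta> > 0" using S(1) \<eta> by (simp add: \<delta>_def)
    have "S * \<delta> \<le> S * (1 / S)" using S(1) by (intro mult_left_mono) (auto simp: \<delta>_def)
    then show "S * \<delta> \<le> 1" using S(1) by simp
    have "20 * S ^ 3 * \<delta> \<le> 20 * S ^ 3 * (\<eta> / (20 * S ^ 3))"
      using S(1) by (intro mult_left_mono) (auto simp: \<delta>_def)
    then show "20 * S ^ 3 * \<delta> \<le> \<eta>" using S(1) by simp
  qed
  have d1: "\<delta> \<le> 1" using mult_right_mono[OF S(1), of \<delta>] \<delta> by linarith
  show ?thesis
  proof (intro exI conjI allI impI)
    show "\<delta> > 0" by fact
    fix x h :: real assume x: "\<bar>x\<bar> < \<delta>" and h: "0 \<le> h" "h < \<delta>"
    define y where "y = \<sigma> * x + b * h"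
    have hh: "h * h \<le> \<delta> * h" using h by (intro mult_right_mono) auto
    have ya: "\<bar>y\<bar> \<le> S * \<delta>"
    proof -
      have "\<bar>y\<bar> \<le> \<bar>\<sigma>\<bar> * \<bar>x\<bar> + \<bar>b\<bar> * \<bar>h\<bar>" unfolding y_def by (metis abs_mult abs_triangle_ineq)
      also have "\<dots> \<le> \<bar>\<sigma>\<bar> * \<delta> + \<bar>b\<bar> * \<delta>" using x h by (intro add_mono mult_left_mono) auto
      also have "\<dots> = (\<bar>\<sigma>\<bar> + \<bar>b\<bar>) * \<delta>" by (simp add: algebra_simps)
      also have "\<dots> \<le> S * \<delta>" using S \<delta> by (intro mult_right_mono) auto
      finally show ?thesis .
    qed
    have S2: "\<sigma>\<^sup>2 \<le> S\<^sup>2" "b\<^sup>2 \<le> S\<^sup>2" "\<bar>\<sigma>\<bar> * \<bar>b\<bar> \<le> S\<^sup>2" "\<bar>\<sigma>\<bar> * (3 * \<kappa>\<^sup>2) \<le> 3 * S ^ 3"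
    proof -
      show "\<sigma>\<^sup>2 \<le> S\<^sup>2" "b\<^sup>2 \<le> S\<^sup>2" using S by (auto simp: abs_le_square_iff[symmetric])
      show "\<bar>\<sigma>\<bar> * \<bar>b\<bar> \<le> S\<^sup>2" unfolding power2_eq_square using S by (intro mult_mono) auto
      have "\<kappa>\<^sup>2 \<le> S\<^sup>2" using S by (auto simp: abs_le_square_iff[symmetric])
      then have "\<bar>\<sigma>\<bar> * \<kappa>\<^sup>2 \<le> S * S\<^sup>2" using S by (intro mult_mono) auto
      then show "\<bar>\<sigma>\<bar> * (3 * \<kappa>\<^sup>2) \<le> 3 * S ^ 3" by (simp add: power2_eq_square power3_eq_cube)
    qed
    have SS: "S\<^sup>2 \<le> S ^ 3" using S(1) by (intro power_increasing) auto
    have y2: "y\<^sup>2 \<le> 2 * S\<^sup>2 * (x\<^sup>2 + h)"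
    proof -
      have "y\<^sup>2 \<le> 2 * (\<sigma> * x)\<^sup>2 + 2 * (b * h)\<^sup>2"
        unfolding y_def using sum_squares_bound[of "\<sigma> * x" "b * h"]
        by (simp add: power2_sum)
      also have "\<dots> = 2 * (\<sigma>\<^sup>2 * x\<^sup>2) + 2 * (b\<^sup>2 * (h * h))" by (simp add: power_mult_distrib power2_eq_square)
      also have "\<dots> \<le> 2 * (S\<^sup>2 * x\<^sup>2) + 2 * (S\<^sup>2 * h)"
      proof (intro add_mono mult_left_mono mult_mono)
        show "h * h \<le> h" using hh mult_right_mono[OF d1 h(1)] by simp
      qed (use S2 h in auto)
      finally show ?thesis by (simp add: algebra_simps)
    qed
    have e1: "\<bar>exp y - 1 - y - y\<^sup>2 / 2\<bar> \<le> 6 * S ^ 3 * \<delta> * (x\<^sup>2 + h)"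
    proof -
      have "\<bar>exp y - 1 - y - y\<^sup>2 / 2\<bar> \<le> 3 * (\<bar>y\<bar> * y\<^sup>2)"
        using ya \<delta> by (intro exp_taylor2) auto
      also have "\<dots> \<le> 3 * ((S * \<delta>) * (2 * S\<^sup>2 * (x\<^sup>2 + h)))"
        using ya y2 \<delta> S by (intro mult_left_mono mult_mono) auto
      finally show ?thesis by (simp add: power2_eq_square power3_eq_cube algebra_simps)
    qed
    have e2: "\<bar>\<sigma> * x * (exp (- \<kappa> * x) - 1 + \<kappa> * x)\<bar> \<le> 3 * S ^ 3 * \<delta> * x\<^sup>2"
    proof -
      have "\<bar>- \<kappa> * x\<bar> \<le> S * \<delta>" unfolding abs_mult abs_minus using x S \<delta> by (intro mult_mono) auto
      then have "\<bar>exp (- \<kappa> * x) - 1 - (- \<kappa> * x)\<bar> \<le> 3 * (- \<kappa> * x)\<^sup>2"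
        using \<delta> by (intro exp_taylor1) auto
      then have "\<bar>\<sigma> * x * (exp (- \<kappa> * x) - 1 + \<kappa> * x)\<bar> \<le> \<bar>\<sigma>\<bar> * \<bar>x\<bar> * (3 * (- \<kappa> * x)\<^sup>2)"
        unfolding abs_mult by (intro mult_mono) auto
      also have "\<dots> = (\<bar>\<sigma>\<bar> * (3 * \<kappa>\<^sup>2)) * (\<bar>x\<bar> * x\<^sup>2)"
        by (simp add: power_mult_distrib algebra_simps)
      also have "\<dots> \<le> (3 * S ^ 3) * (\<delta> * x\<^sup>2)"
      proof (rule mult_mono[OF S2(4)])
        show "\<bar>x\<bar> * x\<^sup>2 \<le> \<delta> * x\<^sup>2" using x by (intro mult_right_mono) auto
      qed (use S(1) in auto)
      finally show ?thesis by simp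
    qed
    have e3: "\<bar>\<sigma> * b * x * h\<bar> \<le> S ^ 3 * \<delta> * h"
    proof -
      have "\<bar>\<sigma> * b * x * h\<bar> = (\<bar>\<sigma>\<bar> * \<bar>b\<bar>) * \<bar>x\<bar> * h" using h by (simp add: abs_mult)
      also have "\<dots> \<le> S ^ 3 * \<delta> * h"
        using S2 SS x h S(1) \<delta>(1) by (intro mult_mono) auto
      finally show ?thesis .
    qed
    have e4: "\<bar>b\<^sup>2 * h\<^sup>2 / 2\<bar> \<le> S ^ 3 * \<delta> * h"
    proof -
      have "0 \<le> b\<^sup>2 * (h * h)" by simp
      then have "\<bar>b\<^sup>2 * h\<^sup>2 / 2\<bar> \<le> b\<^sup>2 * (h * h)" by (simp only: power2_eq_square[of h])
      also have "\<dots> \<le> S ^ 3 * (\<delta> * h)" using S2 SS hh h S(1) by (intro mult_mono) auto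
      finally show ?thesis by simp
    qed
    \<comment> \<open>The last two summands are what y^2/2 contains beyond \<sigma>^2 x^2/2; the
      term \<sigma> \<kappa> x^2 is absorbed by turning exp(-\<kappa> x) into its first-order
      remainder.\<close>
    have "exp (\<sigma> * x + b * h) - 1 - \<sigma> * x * exp (- \<kappa> * x) - b * h - (\<sigma>\<^sup>2 / 2 + \<sigma> * \<kappa>) * x\<^sup>2
       = (exp y - 1 - y - y\<^sup>2 / 2) - \<sigma> * x * (exp (- \<kappa> * x) - 1 + \<kappa> * x) + \<sigma> * b * x * h + b\<^sup>2 * h\<^sup>2 / 2"
    proof -
      have "y\<^sup>2 / 2 = \<sigma>\<^sup>2 * x\<^sup>2 / 2 + \<sigma> * b * x * h + b\<^sup>2 * h\<^sup>2 / 2"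
        unfolding y_def power2_sum power_mult_distrib by simp
      moreover have "\<sigma> * x * (exp (- \<kappa> * x) - 1 + \<kappa> * x)
          = \<sigma> * x * exp (- \<kappa> * x) - \<sigma> * x + \<sigma> * \<kappa> * x\<^sup>2"
        by (simp add: power2_eq_square right_diff_distrib distrib_left)
      moreover have "(\<sigma>\<^sup>2 / 2 + \<sigma> * \<kappa>) * x\<^sup>2 = \<sigma>\<^sup>2 * x\<^sup>2 / 2 + \<sigma> * \<kappa> * x\<^sup>2"
        by (simp add: distrib_right)
      moreover have "exp (\<sigma> * x + b * h) = exp y" "y = \<sigma> * x + b * h" by (simp_all add: y_def)
      ultimately show ?thesis by linarith
    qed
    also have "\<bar>\<dots>\<bar> \<le> 6 * S ^ 3 * \<delta> * (x\<^sup>2 + h) + 3 * S ^ 3 * \<delta> * x\<^sup>2 + S ^ 3 * \<delta> * h + S ^ 3 * \<delta> * h"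
      using e1 e2 e3 e4 by linarith
    also have "\<dots> \<le> 20 * S ^ 3 * \<delta> * (x\<^sup>2 + h)"
    proof -
      have "0 \<le> S ^ 3 * \<delta> * x\<^sup>2" "0 \<le> S ^ 3 * \<delta> * h" using S(1) \<delta>(1) h(1) by auto
      moreover have "6 * S ^ 3 * \<delta> * (x\<^sup>2 + h) = 6 * (S ^ 3 * \<delta> * x\<^sup>2) + 6 * (S ^ 3 * \<delta> * h)"
        "20 * S ^ 3 * \<delta> * (x\<^sup>2 + h) = 20 * (S ^ 3 * \<delta> * x\<^sup>2) + 20 * (S ^ 3 * \<delta> * h)"
        by (simp_all add: distrib_left)
      ultimately show ?thesis by linarith
    qed
    also have "\<dots> \<le> \<eta> * (x\<^sup>2 + h)" using \<delta> h by (intro mult_right_mono) auto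
    finally show "\<bar>exp (\<sigma> * x + b * h) - 1 - \<sigma> * x * exp (- \<kappa> * x) - b * h - (\<sigma>\<^sup>2 / 2 + \<sigma> * \<kappa>) * x\<^sup>2\<bar>
       \<le> \<eta> * (x\<^sup>2 + h)" .
  qed
qed

section \<open>Partition sequences with geometrically decreasing mesh\<close>

lemma ex_partition:
  assumes "a \<le> c" "\<delta> > 0"
  shows "\<exists>ts. is_partition a c ts \<and> (\<forall>i<length ts - 1. ts ! Suc i - ts ! i < \<delta>)"
proof (cases "a = c")
  case True
  then show ?thesis by (intro exI[of _ "[a]"]) (simp add: is_partition_def)
next
  case False
  then have ac: "a < c" using assms by simp
  obtain n :: nat where n: "(c - a) / \<delta> < n" using reals_Archimedean2 by blast
  have n0: "n > 0" using n ac assms by (cases n) (auto simp: field_simps)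
  let ?v = "\<lambda>i. a + (c - a) * (real i / real n)" and ?ts = "map (\<lambda>i. a + (c - a) * (real i / real n)) [0..<Suc n]"
  have "?v i < ?v j" if "i < j" for i j using that ac n0 by (simp add: divide_strict_right_mono)
  then have "sorted_wrt (<) ?ts"
    by (auto simp: sorted_wrt_iff_nth_less nth_append simp del: upt_Suc)
  moreover have "hd ?ts = a" "last ?ts = c" using n0 by (auto simp: hd_map last_map hd_append)
  moreover have "?ts ! Suc i - ?ts ! i < \<delta>" if "i < length ?ts - 1" for i
  proof -
    have "?ts ! Suc i - ?ts ! i = (c - a) / n"
      using that n0 by (simp del: upt_Suc add: field_simps)
    also have "\<dots> < \<delta>" using n n0 assms by (simp add: field_simps)
    finally show ?thesis .
  qed
  ultimately show ?thesis by (intro exI[of _ ?ts]) (auto simp: is_partition_def)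
qed

lemma filterlim_mesh_to_0:
  assumes "\<And>n. is_partition a c (\<pi> n)"
    and mesh: "\<And>n i. i < length (\<pi> n) - 1 \<Longrightarrow> \<pi> n ! Suc i - \<pi> n ! i < (1 / 2) ^ n"
  shows "filterlim \<pi> (mesh_to_0 a c) sequentially"
  unfolding filterlim_iff
proof (intro allI impI)
  fix Q assume "eventually Q (mesh_to_0 a c)"
  then obtain \<delta> :: real where \<delta>: "\<delta> > 0"
    and Q: "\<And>ts. is_partition a c ts \<Longrightarrow> (\<forall>i<length ts - 1. ts ! Suc i - ts ! i < \<delta>) \<Longrightarrow> Q ts"
    unfolding eventually_mesh_to_0 by blast
  have "(\<lambda>n. (1 / 2 :: real) ^ n) \<longlonglongrightarrow> 0" by (rule LIMSEQ_power_zero) simp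
  then have "eventually (\<lambda>n. (1 / 2 :: real) ^ n < \<delta>) sequentially" using \<delta> order_tendstoD(2) by blast
  then show "eventually (\<lambda>n. Q (\<pi> n)) sequentially"
    by eventually_elim (use Q assms order.strict_trans in blast)
qed

text \<open>Supplies one fixed sequence along which Riemann sums converge; a measurable version of
  the time integral is later built from it.\<close>

lemma ex_partition_seq:
  assumes "a \<le> c"
  shows "\<exists>\<pi>. (\<forall>n. is_partition a c (\<pi> n)) \<and> filterlim \<pi> (mesh_to_0 a c) sequentially"
proof -
  have "\<forall>n. \<exists>ts. is_partition a c ts \<and> (\<forall>i<length ts - 1. ts ! Suc i - ts ! i < (1 / 2) ^ n)"
    using ex_partition[OF assms] by simp
  then obtain \<pi> where "\<forall>n. is_partition a c (\<pi> n) \<and>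
      (\<forall>i<length (\<pi> n) - 1. \<pi> n ! Suc i - \<pi> n ! i < (1 / 2) ^ n)" by metis
  then show ?thesis by (intro exI[of _ \<pi>] conjI filterlim_mesh_to_0) auto
qed

text \<open>A deterministic Ito formula in the manner of Foellmer: probability enters only through
  the two assumptions on the sums of \<open>D\<close>. The unweighted one bounds the total of x^2 +
  h and so kills the Taylor remainder; the weighted one replaces squared increments by time
  increments.\<close>

lemma pathwise_ito:
  fixes x :: "real \<Rightarrow> real" and \<sigma> b \<kappa> :: real and \<pi> :: "nat \<Rightarrow> real list"
  defines "z \<equiv> \<lambda>s. exp (\<sigma> * x s + b * s)"
  defines "D \<equiv> \<lambda>u v. (x v - x u)\<^sup>2 - (v - u)"
  assumes x: "continuous_on {a..c} x"
    and \<pi>: "filterlim \<pi> (mesh_to_0 a c) sequentially"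
    and Q: "(\<lambda>n. \<Sum>i<length (\<pi> n) - 1. D (\<pi> n ! i) (\<pi> n ! Suc i)) \<longlonglongrightarrow> 0"
    and QZ: "(\<lambda>n. \<Sum>i<length (\<pi> n) - 1. z (\<pi> n ! i) * D (\<pi> n ! i) (\<pi> n ! Suc i)) \<longlonglongrightarrow> 0"
  shows "(\<lambda>n. \<Sum>i<length (\<pi> n) - 1. \<sigma> * (z (\<pi> n ! i) * exp (- \<kappa> * (x (\<pi> n ! Suc i) - x (\<pi> n ! i)))
              * (x (\<pi> n ! Suc i) - x (\<pi> n ! i))))
           \<longlonglongrightarrow> z c - z a - (b + \<sigma>\<^sup>2 / 2 + \<sigma> * \<kappa>) * (LBINT s:{a..c}. z s)"
proof -
  define \<gamma> where "\<gamma> = \<sigma>\<^sup>2 / 2 + \<sigma> * \<kappa>"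
  define r where "r = (\<lambda>u v. exp (\<sigma> * (x v - x u) + b * (v - u)) - 1
      - \<sigma> * (x v - x u) * exp (- \<kappa> * (x v - x u)) - b * (v - u) - \<gamma> * (x v - x u)\<^sup>2)"
  have part: "eventually (\<lambda>n. is_partition a c (\<pi> n)) sequentially"
    by (rule eventually_compose_filterlim[OF eventually_is_partition \<pi>])
  have mesh: "eventually (\<lambda>n. \<forall>i<length (\<pi> n) - 1. \<pi> n ! Suc i - \<pi> n ! i < \<delta>) sequentially"
    if "\<delta> > 0" for \<delta>
    using eventually_compose_filterlim[OF _ \<pi>, of "\<lambda>ts. \<forall>i<length ts - 1. ts ! Suc i - ts ! i < \<delta>"] that
    by (auto simp: eventually_mesh_to_0)
  obtain n where "is_partition a c (\<pi> n)" using part eventually_happens by fastforce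
  then have ac: "a \<le> c" using is_partition_mem[of a c "\<pi> n" 0] by simp
  have cz: "continuous_on {a..c} z" unfolding z_def using x by (intro continuous_intros)
  have zpos: "z s > 0" for s by (simp add: z_def)
  obtain K where K: "K > 0" "\<And>s. s \<in> {a..c} \<Longrightarrow> z s \<le> K"
  proof -
    have "bounded (z ` {a..c})" using compact_continuous_image[OF cz] compact_imp_bounded by blast
    then obtain K where "\<forall>y\<in>z ` {a..c}. norm y \<le> K" and "K > 0" using bounded_pos by blast
    then show ?thesis by (intro that[of K]) (auto simp: abs_le_iff)
  qed
  \<comment> \<open>The one-cell expansion solved for its stochastic term. Writing the squared
    increment as \<open>D\<close> plus the cell length moves \<gamma> into the drift: the first part
    telescopes, the second is a Riemann sum, and the last two vanish in the limit.\<close>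
  have step: "\<sigma> * (z u * exp (- \<kappa> * (x v - x u)) * (x v - x u))
      = (z v - z u) - (b + \<gamma>) * (z u * (v - u)) - \<gamma> * (z u * D u v) - z u * r u v" for u v
  proof -
    have "z v = z u * exp (\<sigma> * (x v - x u) + b * (v - u))"
      unfolding z_def by (simp add: exp_add[symmetric] algebra_simps)
    then show ?thesis unfolding r_def D_def by (simp add: algebra_simps)
  qed
  have R0: "(\<lambda>n. \<Sum>i<length (\<pi> n) - 1. z (\<pi> n ! i) * r (\<pi> n ! i) (\<pi> n ! Suc i)) \<longlonglongrightarrow> 0"
  proof (rule tendstoI)
    fix \<epsilon> :: real assume \<epsilon>: "\<epsilon> > 0"
    \<comment> \<open>Summed over the cells, x^2 + h is the sum of \<open>D\<close> plus 2 (c - a).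
      Once the sum of \<open>D\<close> is below 1, the bound z \<le> K makes the remainder at most
      \<eta> L, and \<eta> is chosen to turn this into \<epsilon> / 2.\<close>
    define L where "L = K * (1 + 2 * (c - a))"
    have L: "L > 0" using K ac by (simp add: L_def)
    define \<eta> where "\<eta> = \<epsilon> / (2 * L)"
    have \<eta>: "\<eta> > 0" using \<epsilon> L by (simp add: \<eta>_def)
    obtain \<delta> where \<delta>: "\<delta> > 0"
      and rem: "\<And>y h. \<bar>y\<bar> < \<delta> \<Longrightarrow> 0 \<le> h \<Longrightarrow> h < \<delta> \<Longrightarrow>
        \<bar>exp (\<sigma> * y + b * h) - 1 - \<sigma> * y * exp (- \<kappa> * y) - b * h - (\<sigma>\<^sup>2 / 2 + \<sigma> * \<kappa>) * y\<^sup>2\<bar> \<le> \<eta> * (y\<^sup>2 + h)"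
      using ito_expansion[OF \<eta>, of \<sigma> b \<kappa>] by blast
    have "uniformly_continuous_on {a..c} x"
      using x compact_uniformly_continuous by blast
    then obtain \<delta>' where \<delta>': "\<delta>' > 0"
      and uc: "\<And>u v. u \<in> {a..c} \<Longrightarrow> v \<in> {a..c} \<Longrightarrow> dist v u < \<delta>' \<Longrightarrow> dist (x v) (x u) < \<delta>"
      using \<delta> unfolding uniformly_continuous_on_def by metis
    have Q1: "eventually (\<lambda>n. \<bar>\<Sum>i<length (\<pi> n) - 1. D (\<pi> n ! i) (\<pi> n ! Suc i)\<bar> < 1) sequentially"
      using tendstoD[OF Q, of 1] by (simp add: dist_real_def)
    show "eventually (\<lambda>n. dist (\<Sum>i<length (\<pi> n) - 1. z (\<pi> n ! i) * r (\<pi> n ! i) (\<pi> n ! Suc i)) 0 < \<epsilon>) sequentially"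
      using part mesh[of "min \<delta> \<delta>'", simplified min_less_iff_conj, OF conjI[OF \<delta> \<delta>']] Q1
    proof eventually_elim
      case (elim n)
      let ?ts = "\<pi> n" and ?N = "length (\<pi> n) - 1"
      have "\<bar>\<Sum>i<?N. z (?ts ! i) * r (?ts ! i) (?ts ! Suc i)\<bar>
          \<le> (\<Sum>i<?N. K * (\<eta> * (D (?ts ! i) (?ts ! Suc i) + 2 * (?ts ! Suc i - ?ts ! i))))"
      proof (rule order_trans[OF sum_abs sum_mono])
        fix i assume "i \<in> {..<?N}"
        then have i: "i < ?N" by simp
        have u: "?ts ! i \<in> {a..c}" "?ts ! Suc i \<in> {a..c}" "?ts ! i < ?ts ! Suc i"
          using is_partition_mem[OF elim(1)] is_partition_less[OF elim(1) i] i by auto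
        have m: "?ts ! Suc i - ?ts ! i < \<delta>" "?ts ! Suc i - ?ts ! i < \<delta>'" using elim(2) i by auto
        have "\<bar>x (?ts ! Suc i) - x (?ts ! i)\<bar> < \<delta>"
          using uc[of "?ts ! i" "?ts ! Suc i"] u m by (auto simp: dist_real_def)
        then have "\<bar>r (?ts ! i) (?ts ! Suc i)\<bar>
            \<le> \<eta> * ((x (?ts ! Suc i) - x (?ts ! i))\<^sup>2 + (?ts ! Suc i - ?ts ! i))"
          unfolding r_def \<gamma>_def using u m by (intro rem) auto
        also have "(x (?ts ! Suc i) - x (?ts ! i))\<^sup>2 + (?ts ! Suc i - ?ts ! i)
            = D (?ts ! i) (?ts ! Suc i) + 2 * (?ts ! Suc i - ?ts ! i)" by (simp add: D_def)
        finally show "\<bar>z (?ts ! i) * r (?ts ! i) (?ts ! Suc i)\<bar>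
            \<le> K * (\<eta> * (D (?ts ! i) (?ts ! Suc i) + 2 * (?ts ! Suc i - ?ts ! i)))"
          unfolding abs_mult using K(1) K(2)[OF u(1)] zpos[of "?ts ! i"] by (intro mult_mono) auto
      qed
      also have "\<dots> = K * \<eta> * ((\<Sum>i<?N. D (?ts ! i) (?ts ! Suc i)) + 2 * (c - a))"
        unfolding sum_distrib_left[symmetric] sum.distrib is_partition_telescope[OF elim(1), of "\<lambda>s. s"]
        by (simp only: mult.assoc)
      also have "\<dots> \<le> K * \<eta> * (1 + 2 * (c - a))"
        using elim(3) K \<eta> by (intro mult_left_mono) auto
      also have "\<dots> = \<eta> * L" by (simp only: L_def ac_simps)
      also have "\<dots> = \<epsilon> / 2" using L by (simp add: \<eta>_def)
      also have "\<dots> < \<epsilon>" using \<epsilon> by simp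
      finally show ?case by (simp add: dist_real_def)
    qed
  qed
  have I: "(\<lambda>n. \<Sum>i<length (\<pi> n) - 1. z (\<pi> n ! i) * (\<pi> n ! Suc i - \<pi> n ! i)) \<longlonglongrightarrow> (LBINT s:{a..c}. z s)"
    by (rule filterlim_compose[OF riemann_sums_tendsto[OF cz] \<pi>])
  have "(\<lambda>n. (z c - z a) - (b + \<gamma>) * (\<Sum>i<length (\<pi> n) - 1. z (\<pi> n ! i) * (\<pi> n ! Suc i - \<pi> n ! i))
          - \<gamma> * (\<Sum>i<length (\<pi> n) - 1. z (\<pi> n ! i) * D (\<pi> n ! i) (\<pi> n ! Suc i))
          - (\<Sum>i<length (\<pi> n) - 1. z (\<pi> n ! i) * r (\<pi> n ! i) (\<pi> n ! Suc i)))
      \<longlonglongrightarrow> (z c - z a) - (b + \<gamma>) * (LBINT s:{a..c}. z s) - \<gamma> * 0 - 0" (is "?S \<longlonglongrightarrow> _")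
    by (intro tendsto_intros I QZ R0)
  then have "?S \<longlonglongrightarrow> z c - z a - (b + \<sigma>\<^sup>2 / 2 + \<sigma> * \<kappa>) * (LBINT s:{a..c}. z s)"
    by (rule tendsto_eq_rhs) (simp add: \<gamma>_def add.assoc)
  moreover have "eventually (\<lambda>n. ?S n
        = (\<Sum>i<length (\<pi> n) - 1. \<sigma> * (z (\<pi> n ! i) * exp (- \<kappa> * (x (\<pi> n ! Suc i) - x (\<pi> n ! i)))
              * (x (\<pi> n ! Suc i) - x (\<pi> n ! i))))) sequentially"
    using part
  proof eventually_elim
    case (elim n)
    show ?case
      by (simp only: is_partition_telescope[OF elim, of z, symmetric] step sum_subtractf sum_distrib_left)
  qed
  ultimately show ?thesis by (rule Lim_transform_eventually)
qed

section \<open>Almost sure convergence and convergence in probability\<close>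

context prob_space
begin

text \<open>The sum over n of the squares has finite expectation, hence is finite almost surely, and
  the terms of a convergent series tend to zero. The geometric rate is what ties this to partitions
  of mesh below 2^-n.\<close>

lemma AE_tendsto_0_if_second_moments:
  assumes int: "\<And>n. integrable M (\<lambda>\<omega>. (S n \<omega> :: real)\<^sup>2)"
    and le: "\<And>n. expectation (\<lambda>\<omega>. (S n \<omega>)\<^sup>2) \<le> C * (1 / 2) ^ n"
  shows "AE \<omega> in M. (\<lambda>n. S n \<omega>) \<longlonglongrightarrow> 0"
proof -
  have [measurable]: "(\<lambda>\<omega>. (S n \<omega>)\<^sup>2) \<in> borel_measurable M" for n using int by blast
  have C: "0 \<le> C" using order_trans[OF Bochner_Integration.integral_nonneg le[of 0]] by simp
  have "(\<integral>\<^sup>+\<omega>. (\<Sum>n. ennreal ((S n \<omega>)\<^sup>2)) \<partial>M) = (\<Sum>n. \<integral>\<^sup>+\<omega>. ennreal ((S n \<omega>)\<^sup>2) \<partial>M)"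
    by (rule nn_integral_suminf) measurable
  also have "\<dots> \<le> (\<Sum>n. ennreal (C * (1 / 2) ^ n))"
    using le by (intro suminf_le) (auto simp: nn_integral_eq_integral[OF int] intro: ennreal_leI)
  also have "\<dots> = ennreal (\<Sum>n. C * (1 / 2) ^ n)"
    using C by (intro suminf_ennreal2 summable_mult summable_geometric) auto
  finally have "(\<integral>\<^sup>+\<omega>. (\<Sum>n. ennreal ((S n \<omega>)\<^sup>2)) \<partial>M) \<noteq> \<infinity>" by (auto simp: top_unique)
  then have "AE \<omega> in M. (\<Sum>n. ennreal ((S n \<omega>)\<^sup>2)) \<noteq> \<infinity>"
    by (intro nn_integral_noteq_infinite) measurable
  then show ?thesis
  proof eventually_elim
    case (elim \<omega>)
    then have "summable (\<lambda>n. (S n \<omega>)\<^sup>2)" by (intro summable_suminf_not_top) auto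
    then have "(\<lambda>n. (S n \<omega>)\<^sup>2) \<longlonglongrightarrow> 0" by (rule summable_LIMSEQ_zero)
    from tendsto_real_sqrt[OF this] show ?case by (simp add: tendsto_rabs_zero_iff)
  qed
qed

lemma AE_tendsto_imp_tendsto_in_prob:
  assumes [measurable]: "\<And>n. X n \<in> borel_measurable M" "Y \<in> borel_measurable M"
    and lim: "AE \<omega> in M. (\<lambda>n. X n \<omega>) \<longlonglongrightarrow> Y \<omega>"
  shows "tendsto_in_prob M X Y sequentially"
  unfolding tendsto_in_prob_def
proof (intro conjI allI impI)
  fix \<epsilon> :: real assume \<epsilon>: "\<epsilon> > 0"
  let ?A = "\<lambda>n. {\<omega> \<in> space M. \<bar>X n \<omega> - Y \<omega>\<bar> > \<epsilon>}"
  have [measurable]: "?A n \<in> sets M" for n by measurable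
  have "(\<lambda>n. expectation (indicator (?A n) :: _ \<Rightarrow> real)) \<longlonglongrightarrow> expectation (\<lambda>_. 0)"
  proof (rule integral_dominated_convergence[where w = "\<lambda>_. 1"])
    show "AE \<omega> in M. (\<lambda>n. indicator (?A n) \<omega> :: real) \<longlonglongrightarrow> 0"
      using lim
    proof eventually_elim
      case (elim \<omega>)
      have "eventually (\<lambda>n. dist (X n \<omega>) (Y \<omega>) < \<epsilon>) sequentially" using elim \<epsilon> by (rule tendstoD)
      then have "eventually (\<lambda>n. indicator (?A n) \<omega> = (0::real)) sequentially"
        by eventually_elim (auto simp: dist_real_def indicator_def)
      then show ?case by (rule tendsto_eventually)
    qed
  qed (auto simp: indicator_def)
  then show "(\<lambda>n. measure M (?A n)) \<longlonglongrightarrow> 0" by simp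
qed fact

text \<open>If convergence failed, there would be a bad partition below every mesh 2^-n, and the
  sequence of these would contradict the assumption. Only rapidly refining sequences have to be
  examined, exactly those whose second moments are summable; the exceptional null set may depend on
  the sequence.\<close>

lemma tendsto_in_prob_mesh_to_0:
  assumes X: "\<And>ts. is_partition a c ts \<Longrightarrow> X ts \<in> borel_measurable M" and Y: "Y \<in> borel_measurable M"
    and lim: "\<And>\<pi>. (\<And>n. is_partition a c (\<pi> n)) \<Longrightarrow>
      (\<And>n i. i < length (\<pi> n) - 1 \<Longrightarrow> \<pi> n ! Suc i - \<pi> n ! i < (1 / 2) ^ n) \<Longrightarrow>
      AE \<omega> in M. (\<lambda>n. X (\<pi> n) \<omega>) \<longlonglongrightarrow> Y \<omega>"
  shows "tendsto_in_prob M X Y (mesh_to_0 a c)"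
  unfolding tendsto_in_prob_def
proof (intro conjI allI impI tendstoI Y, rule ccontr)
  fix \<epsilon> \<eta> :: real assume \<epsilon>: "\<epsilon> > 0" and \<eta>: "\<eta> > 0"
  let ?m = "\<lambda>ts. measure M {\<omega> \<in> space M. \<bar>X ts \<omega> - Y \<omega>\<bar> > \<epsilon>}"
  assume not_ev: "\<not> eventually (\<lambda>ts. dist (?m ts) 0 < \<eta>) (mesh_to_0 a c)"
  have "\<exists>ts. is_partition a c ts \<and>
      (\<forall>i<length ts - 1. ts ! Suc i - ts ! i < (1 / 2) ^ n) \<and> \<not> dist (?m ts) 0 < \<eta>" for n :: nat
  proof (rule ccontr)
    assume "\<nexists>ts. is_partition a c ts \<and>
      (\<forall>i<length ts - 1. ts ! Suc i - ts ! i < (1 / 2) ^ n) \<and> \<not> dist (?m ts) 0 < \<eta>"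
    then have "eventually (\<lambda>ts. dist (?m ts) 0 < \<eta>) (mesh_to_0 a c)"
      unfolding eventually_mesh_to_0 by (intro exI[of _ "(1 / 2) ^ n"] conjI) (simp, blast)
    with not_ev show False ..
  qed
  then have "\<exists>\<pi>. \<forall>n. is_partition a c (\<pi> n) \<and>
      (\<forall>i<length (\<pi> n) - 1. \<pi> n ! Suc i - \<pi> n ! i < (1 / 2) ^ n) \<and> \<not> dist (?m (\<pi> n)) 0 < \<eta>"
    by (intro choice allI)
  then obtain \<pi> where \<pi>: "\<And>n. is_partition a c (\<pi> n)"
    "\<And>n i. i < length (\<pi> n) - 1 \<Longrightarrow> \<pi> n ! Suc i - \<pi> n ! i < (1 / 2) ^ n"
    "\<And>n. \<not> dist (?m (\<pi> n)) 0 < \<eta>" by blast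
  have "tendsto_in_prob M (\<lambda>n. X (\<pi> n)) Y sequentially"
    using lim[OF \<pi>(1,2)] X \<pi>(1) Y by (intro AE_tendsto_imp_tendsto_in_prob) auto
  then have "(\<lambda>n. ?m (\<pi> n)) \<longlonglongrightarrow> 0" using \<epsilon> by (simp add: tendsto_in_prob_def)
  then have "eventually (\<lambda>n. dist (?m (\<pi> n)) 0 < \<eta>) sequentially" using \<eta> by (rule tendstoD)
  then show False using \<pi>(3) by simp
qed

end

section \<open>Quadratic variation\<close>

locale brownian_setting = prob_space P for P :: "'a measure" +
  fixes F :: "real \<Rightarrow> 'a measure" and B :: "real \<Rightarrow> 'a \<Rightarrow> real"
  assumes bm: "standard_brownian_motion P B"
    and filt: "brownian_filtration P F B"
begin

section \<open>Measurability, independence and moments of increments\<close>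

lemma B_measurable: "0 \<le> t \<Longrightarrow> B t \<in> borel_measurable P"
  using bm by (simp add: standard_brownian_motion_def)

lemma B_adapted: "0 \<le> t \<Longrightarrow> B t \<in> borel_measurable (F t)"
  using filt by (simp add: brownian_filtration_def)

lemma measurable_from_F: "0 \<le> t \<Longrightarrow> X \<in> borel_measurable (F t) \<Longrightarrow> X \<in> borel_measurable P"
  using filt measurable_from_subalg unfolding brownian_filtration_def by blast

lemma measurable_F_mono:
  "0 \<le> s \<Longrightarrow> s \<le> t \<Longrightarrow> X \<in> borel_measurable (F s) \<Longrightarrow> X \<in> borel_measurable (F t)"
  using filt measurable_from_subalg unfolding brownian_filtration_def by blast

lemma AE_continuous: "AE \<omega> in P. continuous_on {0..} (\<lambda>t. B t \<omega>)"
  using bm by (simp add: standard_brownian_motion_def)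

lemma increment_distributed:
  "0 \<le> s \<Longrightarrow> s < t \<Longrightarrow>
    distributed P lborel (\<lambda>\<omega>. B t \<omega> - B s \<omega>) (normal_density 0 (sqrt (t - s)))"
  using bm by (simp add: standard_brownian_motion_def)

lemma indep_var_increment:
  fixes U :: "'a \<Rightarrow> real" and h :: "real \<Rightarrow> real"
  assumes st: "0 \<le> s" "s < t" and U: "U \<in> borel_measurable (F s)"
    and h: "h \<in> borel_measurable borel"
  shows "indep_var borel U borel (\<lambda>\<omega>. h (B t \<omega> - B s \<omega>))"
proof -
  let ?X = "\<lambda>\<omega>. B t \<omega> - B s \<omega>"
  have X: "?X \<in> borel_measurable P"
    using B_measurable[of s] B_measurable[of t] st by simp
  have sub: "subalgebra P (F s)" using filt st by (simp add: brownian_filtration_def)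
  then have sp: "space (F s) = space P" by (simp add: subalgebra_def)
  have ind: "indep_set (sets (F s)) (sigma_of P ?X)"
    using filt st by (simp add: brownian_filtration_def)
  have 1: "sigma_sets (space P) {U -` A \<inter> space P |A. A \<in> sets borel} \<subseteq> sets (F s)"
    using U measurable_sets[of U "F s" borel] unfolding sp[symmetric]
    by (intro sets.sigma_sets_subset) auto
  \<comment> \<open>Preimages of Borel sets already form a \<sigma>-algebra, so generating from them
    adds nothing.\<close>
  have 2: "sigma_sets (space P) {?X -` A \<inter> space P |A. A \<in> sets borel} \<subseteq> sigma_of P ?X"
  proof -
    have "sigma_of P ?X = sets (vimage_algebra (space P) ?X borel)"
      unfolding sigma_of_def by (subst sets_vimage_algebra2) auto
    then show ?thesis
      by (metis order_refl sets.sigma_sets_eq sigma_of_def space_vimage_algebra)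
  qed
  have "indep_set (sigma_sets (space P) {U -` A \<inter> space P |A. A \<in> sets borel})
      (sigma_sets (space P) {?X -` A \<inter> space P |A. A \<in> sets borel})"
    using ind 1 2 unfolding indep_set_def
    by (elim indep_sets_mono_sets) (auto split: bool.split)
  then have "indep_var borel U borel ?X"
    unfolding indep_var_eq using measurable_from_F[OF st(1) U] X by simp
  then show ?thesis
    using indep_var_compose[of borel U borel ?X "\<lambda>x. x" borel h borel] h by (simp add: comp_def)
qed

text \<open>A centred Gaussian of variance h has fourth moment 3 h^2, so its square has variance 3
  h^2 - h^2. Being of second order in h, these variances sum to something proportional to the
  mesh.\<close>

lemma increment_moments:
  assumes st: "0 \<le> s" "s < t"
  defines "D \<equiv> \<lambda>\<omega>. (B t \<omega> - B s \<omega>)\<^sup>2 - (t - s)"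
  shows "integrable P D" "expectation D = 0"
    "integrable P (\<lambda>\<omega>. (D \<omega>)\<^sup>2)" "expectation (\<lambda>\<omega>. (D \<omega>)\<^sup>2) = 2 * (t - s)\<^sup>2"
proof -
  let ?X = "\<lambda>\<omega>. B t \<omega> - B s \<omega>" and ?\<sigma> = "sqrt (t - s)"
  have \<sigma>: "?\<sigma> > 0" using st by simp
  note d = increment_distributed[OF st]
  have i: "integrable P (\<lambda>\<omega>. ?X \<omega> ^ k)" for k
    using distributed_integrable[OF d, of "\<lambda>x. x ^ k"] integrable_normal_moment[OF \<sigma>, of 0 k] by simp
  have e: "expectation (\<lambda>\<omega>. ?X \<omega> ^ (2 * k)) = fact (2 * k) / ((2 / ?\<sigma>\<^sup>2) ^ k * fact k)" for k
    using distributed_integral[OF d, of "\<lambda>x. x ^ (2 * k)"] integral_normal_moment_even[OF \<sigma>, of 0 k] by simp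
  have e2: "expectation (\<lambda>\<omega>. (?X \<omega>)\<^sup>2) = t - s"
    using e[of 1] st by (simp add: fact_numeral)
  have e4: "expectation (\<lambda>\<omega>. ?X \<omega> ^ 4) = 3 * (t - s)\<^sup>2"
    using e[of 2] st by (simp add: fact_numeral power_divide field_simps)
  show "integrable P D" unfolding D_def using i[of 2] by simp
  show "expectation D = 0" unfolding D_def using i[of 2] e2 by (simp add: prob_space)
  have sq: "(\<lambda>\<omega>. (D \<omega>)\<^sup>2) = (\<lambda>\<omega>. ?X \<omega> ^ 4 - 2 * (t - s) * (?X \<omega>)\<^sup>2 + (t - s)\<^sup>2)"
    by (rule ext) (simp add: D_def power2_eq_square power4_eq_xxxx algebra_simps)
  show "integrable P (\<lambda>\<omega>. (D \<omega>)\<^sup>2)" unfolding sq using i[of 2] i[of 4] by simp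
  show "expectation (\<lambda>\<omega>. (D \<omega>)\<^sup>2) = 2 * (t - s)\<^sup>2"
    unfolding sq using i[of 2] i[of 4] 
    by (simp add: prob_space e2 e4) (simp add: power2_eq_square)
qed

text \<open>The partial sums form a martingale along the partition: \<open>G\<close> and the
  previous sum are known at the left endpoint, while \<open>D\<close> is centred and independent of
  that past. Cross terms vanish, second moments add, and a cell of length h contributes at most 2
  K^2 h^2 \<le> 2 K^2 \<delta> h.\<close>

lemma quadratic_variation_moment:
  fixes G :: "real \<Rightarrow> 'a \<Rightarrow> real"
  assumes a: "0 \<le> a" and ts: "is_partition a c ts"
    and mesh: "\<And>i. i < length ts - 1 \<Longrightarrow> ts ! Suc i - ts ! i \<le> \<delta>"
    and G: "adapted_on F a c G" "\<And>s \<omega>. s \<in> {a..c} \<Longrightarrow> \<bar>G s \<omega>\<bar> \<le> K"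
  defines "D \<equiv> \<lambda>i \<omega>. (B (ts ! Suc i) \<omega> - B (ts ! i) \<omega>)\<^sup>2 - (ts ! Suc i - ts ! i)"
  defines "S \<equiv> \<lambda>m \<omega>. \<Sum>i<m. G (ts ! i) \<omega> * D i \<omega>"
  shows "integrable P (\<lambda>\<omega>. (S (length ts - 1) \<omega>)\<^sup>2)"
    and "expectation (\<lambda>\<omega>. (S (length ts - 1) \<omega>)\<^sup>2) \<le> 2 * K\<^sup>2 * \<delta> * (c - a)"
proof -
  let ?N = "length ts - 1"
  \<comment> \<open>Measurability of the partial sum at its current time belongs to the induction
    claim, because independence from the next increment rests on it.\<close>
  have "m \<le> ?N \<Longrightarrow> S m \<in> borel_measurable (F (ts ! m)) \<and> integrable P (\<lambda>\<omega>. (S m \<omega>)\<^sup>2) \<and>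
      expectation (\<lambda>\<omega>. (S m \<omega>)\<^sup>2) \<le> 2 * K\<^sup>2 * \<delta> * (\<Sum>i<m. ts ! Suc i - ts ! i)" for m
  proof (induction m)
    case 0
    then show ?case by (simp add: S_def)
  next
    case (Suc m)
    let ?u = "ts ! m" and ?v = "ts ! Suc m"
    have mN: "m < ?N" using Suc.prems by simp
    have uv: "0 \<le> ?u" "?u < ?v" "?u \<in> {a..c}" "0 \<le> ?v"
      using is_partition_mem[OF ts, of m] is_partition_mem[OF ts, of "Suc m"]
        is_partition_less[OF ts mN] mN a by auto
    from Suc.IH mN have Sm: "S m \<in> borel_measurable (F ?u)" "integrable P (\<lambda>\<omega>. (S m \<omega>)\<^sup>2)"
      "expectation (\<lambda>\<omega>. (S m \<omega>)\<^sup>2) \<le> 2 * K\<^sup>2 * \<delta> * (\<Sum>i<m. ts ! Suc i - ts ! i)" by auto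
    have Gm: "G ?u \<in> borel_measurable (F ?u)" using G(1) uv by (auto simp: adapted_on_def)
    have SmP: "S m \<in> borel_measurable P" and GmP: "G ?u \<in> borel_measurable P"
      using measurable_from_F[OF uv(1)] Sm(1) Gm by auto
    have DP: "D m \<in> borel_measurable P"
      unfolding D_def using B_measurable uv by simp
    have S1: "S (Suc m) = (\<lambda>\<omega>. S m \<omega> + G ?u \<omega> * D m \<omega>)" by (simp add: S_def fun_eq_iff)
    have "D m \<in> borel_measurable (F ?v)"
      unfolding D_def
      using B_adapted[OF uv(4)] measurable_F_mono[OF uv(1) _ B_adapted[OF uv(1)], of ?v] uv by simp
    then have meas: "S (Suc m) \<in> borel_measurable (F ?v)"
      unfolding S1 using measurable_F_mono[OF uv(1) less_imp_le[OF uv(2)]] Sm(1) Gm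
      by (intro borel_measurable_add borel_measurable_times) auto
    have iS: "integrable P (S m)"
      by (rule square_integrable_imp_integrable[OF SmP Sm(2)])
    have iSG: "integrable P (\<lambda>\<omega>. S m \<omega> * G ?u \<omega>)"
    proof (rule Bochner_Integration.integrable_bound[where f="\<lambda>\<omega>. K * S m \<omega>"])
      have "\<bar>S m \<omega>\<bar> * \<bar>G ?u \<omega>\<bar> \<le> \<bar>K\<bar> * \<bar>S m \<omega>\<bar>" for \<omega>
        using mult_right_mono[OF order_trans[OF G(2)[OF uv(3), of \<omega>] abs_ge_self], of "\<bar>S m \<omega>\<bar>"]
        by (simp add: mult.commute)
      then show "AE \<omega> in P. norm (S m \<omega> * G ?u \<omega>) \<le> norm (K * S m \<omega>)"
        by (simp add: abs_mult)
    qed (use iS SmP GmP in auto)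
    have Dm: "(B ?v \<omega> - B ?u \<omega>)\<^sup>2 - (?v - ?u) = D m \<omega>" for \<omega> by (simp add: D_def)
    note mom = increment_moments[OF uv(1,2), unfolded Dm]
    have ind: "indep_var borel (\<lambda>\<omega>. S m \<omega> * G ?u \<omega>) borel (D m)"
      unfolding D_def
      using indep_var_increment[OF uv(1,2), of "\<lambda>\<omega>. S m \<omega> * G ?u \<omega>" "\<lambda>x. x\<^sup>2 - (?v - ?u)"] Sm(1) Gm
      by simp
    have cross: "integrable P (\<lambda>\<omega>. S m \<omega> * G ?u \<omega> * D m \<omega>)"
      "expectation (\<lambda>\<omega>. S m \<omega> * G ?u \<omega> * D m \<omega>) = 0"
      using indep_var_integrable[OF ind iSG mom(1)] indep_var_lebesgue_integral[OF ind iSG mom(1)] mom(2)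
      by auto
    have GK: "(G ?u \<omega>)\<^sup>2 * (D m \<omega>)\<^sup>2 \<le> K\<^sup>2 * (D m \<omega>)\<^sup>2" for \<omega>
      using G(2)[OF uv(3), of \<omega>] by (intro mult_right_mono) (auto simp: abs_le_square_iff[symmetric])
    have iGD: "integrable P (\<lambda>\<omega>. (G ?u \<omega>)\<^sup>2 * (D m \<omega>)\<^sup>2)"
      by (rule Bochner_Integration.integrable_bound[where f="\<lambda>\<omega>. K\<^sup>2 * (D m \<omega>)\<^sup>2"])
        (use mom(3) GmP DP GK in auto)
    have "expectation (\<lambda>\<omega>. (G ?u \<omega>)\<^sup>2 * (D m \<omega>)\<^sup>2) \<le> expectation (\<lambda>\<omega>. K\<^sup>2 * (D m \<omega>)\<^sup>2)"
      using iGD mom(3) GK by (intro integral_mono) auto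
    also have "\<dots> = 2 * K\<^sup>2 * (?v - ?u)\<^sup>2" using mom(4) by simp
    also have "\<dots> \<le> 2 * K\<^sup>2 * (\<delta> * (?v - ?u))"
      unfolding power2_eq_square[of "?v - ?u"]
      using mesh[OF mN] uv by (intro mult_left_mono mult_right_mono) auto
    finally have le: "expectation (\<lambda>\<omega>. (G ?u \<omega>)\<^sup>2 * (D m \<omega>)\<^sup>2) \<le> 2 * K\<^sup>2 * \<delta> * (?v - ?u)" by simp
    have sq: "(\<lambda>\<omega>. (S (Suc m) \<omega>)\<^sup>2) =
        (\<lambda>\<omega>. (S m \<omega>)\<^sup>2 + 2 * (S m \<omega> * G ?u \<omega> * D m \<omega>) + (G ?u \<omega>)\<^sup>2 * (D m \<omega>)\<^sup>2)"
      unfolding S1 by (rule ext) (simp add: power2_eq_square algebra_simps)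
    have "expectation (\<lambda>\<omega>. (S (Suc m) \<omega>)\<^sup>2)
        = expectation (\<lambda>\<omega>. (S m \<omega>)\<^sup>2) + expectation (\<lambda>\<omega>. (G ?u \<omega>)\<^sup>2 * (D m \<omega>)\<^sup>2)"
      unfolding sq using Sm(2) cross iGD by simp
    moreover have "integrable P (\<lambda>\<omega>. (S (Suc m) \<omega>)\<^sup>2)"
      unfolding sq using Sm(2) cross(1) iGD by simp
    ultimately show ?case using meas le Sm(3) by (simp add: algebra_simps)
  qed
  from this[of ?N] show "integrable P (\<lambda>\<omega>. (S ?N \<omega>)\<^sup>2)"
    "expectation (\<lambda>\<omega>. (S ?N \<omega>)\<^sup>2) \<le> 2 * K\<^sup>2 * \<delta> * (c - a)"
    using is_partition_telescope[OF ts, of "\<lambda>s. s"] by auto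
qed

lemma AE_quadratic_variation:
  assumes a: "0 \<le> a" and \<pi>: "\<And>n. is_partition a c (\<pi> n)"
    and mesh: "\<And>n i. i < length (\<pi> n) - 1 \<Longrightarrow> \<pi> n ! Suc i - \<pi> n ! i < (1 / 2) ^ n"
    and G: "adapted_on F a c G" "\<And>s \<omega>. s \<in> {a..c} \<Longrightarrow> \<bar>G s \<omega>\<bar> \<le> K"
  shows "AE \<omega> in P. (\<lambda>n. \<Sum>i<length (\<pi> n) - 1. G (\<pi> n ! i) \<omega> *
     ((B (\<pi> n ! Suc i) \<omega> - B (\<pi> n ! i) \<omega>)\<^sup>2 - (\<pi> n ! Suc i - \<pi> n ! i))) \<longlonglongrightarrow> 0"
proof (rule AE_tendsto_0_if_second_moments)
  note q = quadratic_variation_moment[OF a \<pi> less_imp_le[OF mesh] G]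
  fix n
  show "integrable P (\<lambda>\<omega>. (\<Sum>i<length (\<pi> n) - 1. G (\<pi> n ! i) \<omega> *
     ((B (\<pi> n ! Suc i) \<omega> - B (\<pi> n ! i) \<omega>)\<^sup>2 - (\<pi> n ! Suc i - \<pi> n ! i)))\<^sup>2)"
    by (rule q(1))
  show "expectation (\<lambda>\<omega>. (\<Sum>i<length (\<pi> n) - 1. G (\<pi> n ! i) \<omega> *
     ((B (\<pi> n ! Suc i) \<omega> - B (\<pi> n ! i) \<omega>)\<^sup>2 - (\<pi> n ! Suc i - \<pi> n ! i)))\<^sup>2)
     \<le> (2 * K\<^sup>2 * (c - a)) * (1 / 2) ^ n"
    using q(2)[of n] by (simp only: ac_simps)
qed

text \<open>Removes the truncation of the integrand, which only the moment bound needs, path by path.\<close>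

lemma AE_exp_ito_sums:
  fixes \<sigma> b \<kappa> :: real
  assumes t: "0 \<le> t" and \<pi>: "\<And>n. is_partition 0 t (\<pi> n)"
    and mesh: "\<And>n i. i < length (\<pi> n) - 1 \<Longrightarrow> \<pi> n ! Suc i - \<pi> n ! i < (1 / 2) ^ n"
  defines "Z \<equiv> \<lambda>s \<omega>. exp (\<sigma> * B s \<omega> + b * s)"
  shows "AE \<omega> in P. (\<lambda>n. \<Sum>i<length (\<pi> n) - 1. \<sigma> * (Z (\<pi> n ! i) \<omega> *
      exp (- \<kappa> * (B (\<pi> n ! Suc i) \<omega> - B (\<pi> n ! i) \<omega>)) * (B (\<pi> n ! Suc i) \<omega> - B (\<pi> n ! i) \<omega>)))
    \<longlonglongrightarrow> Z t \<omega> - Z 0 \<omega> - (b + \<sigma>\<^sup>2 / 2 + \<sigma> * \<kappa>) * (LBINT s:{0..t}. Z s \<omega>)"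
proof -
  let ?D = "\<lambda>\<omega> u v. (B v \<omega> - B u \<omega>)\<^sup>2 - (v - u)"
  \<comment> \<open>The levels are natural numbers, so one null set serves all of them and the level
    can be picked after the path, above its maximum on [0, t].\<close>
  have trunc: "AE \<omega> in P. \<forall>K. (\<lambda>n. \<Sum>i<length (\<pi> n) - 1. min (Z (\<pi> n ! i) \<omega>) (real K) *
      ?D \<omega> (\<pi> n ! i) (\<pi> n ! Suc i)) \<longlonglongrightarrow> 0"
    unfolding AE_all_countable
  proof
    fix K :: nat
    have "adapted_on F 0 t (\<lambda>s \<omega>. min (Z s \<omega>) (real K))"
      unfolding adapted_on_def Z_def using B_adapted by auto
    then show "AE \<omega> in P. (\<lambda>n. \<Sum>i<length (\<pi> n) - 1. min (Z (\<pi> n ! i) \<omega>) (real K) *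
        ?D \<omega> (\<pi> n ! i) (\<pi> n ! Suc i)) \<longlonglongrightarrow> 0"
      by (intro AE_quadratic_variation[where K = "real K", OF order_refl \<pi>] mesh) (auto simp: Z_def)
  qed
  have one: "AE \<omega> in P. (\<lambda>n. \<Sum>i<length (\<pi> n) - 1. 1 * ?D \<omega> (\<pi> n ! i) (\<pi> n ! Suc i)) \<longlonglongrightarrow> 0"
    by (intro AE_quadratic_variation[where K = 1, OF order_refl \<pi>] mesh) (auto simp: adapted_on_def)
  from AE_continuous trunc one show ?thesis
  proof eventually_elim
    case (elim \<omega>)
    have cont: "continuous_on {0..t} (\<lambda>s. B s \<omega>)" using elim(1) by (rule continuous_on_subset) auto
    then have "continuous_on {0..t} (\<lambda>s. Z s \<omega>)" unfolding Z_def by (intro continuous_intros)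
    then have "bounded ((\<lambda>s. Z s \<omega>) ` {0..t})"
      using compact_continuous_image compact_imp_bounded by blast
    then obtain C where "\<forall>y\<in>(\<lambda>s. Z s \<omega>) ` {0..t}. norm y \<le> C" by (auto simp: bounded_iff)
    moreover obtain K :: nat where "C \<le> K" using real_arch_simple by blast
    ultimately have K: "Z s \<omega> \<le> K" if "s \<in> {0..t}" for s
      using that by (smt (verit, best) imageI real_norm_def)
    have "min (Z (\<pi> n ! i) \<omega>) K = Z (\<pi> n ! i) \<omega>" if "i \<in> {..<length (\<pi> n) - 1}" for n i
      using K[OF is_partition_mem[OF \<pi>[of n], of i]] that by simp
    then have eq: "(\<lambda>n. \<Sum>i<length (\<pi> n) - 1. min (Z (\<pi> n ! i) \<omega>) (real K) * ?D \<omega> (\<pi> n ! i) (\<pi> n ! Suc i))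
       = (\<lambda>n. \<Sum>i<length (\<pi> n) - 1. Z (\<pi> n ! i) \<omega> * ?D \<omega> (\<pi> n ! i) (\<pi> n ! Suc i))"
      by (intro ext sum.cong) auto
    have "(\<lambda>n. \<Sum>i<length (\<pi> n) - 1. Z (\<pi> n ! i) \<omega> * ?D \<omega> (\<pi> n ! i) (\<pi> n ! Suc i)) \<longlonglongrightarrow> 0"
      using spec[OF elim(2), of K] unfolding eq .
    then show ?case
      unfolding Z_def using elim(3)
      by (intro pathwise_ito[OF cont filterlim_mesh_to_0] \<pi> mesh) auto
  qed
qed

subsection \<open>The integral of exponentials\<close>

text \<open>The closed form for an exponential strategy with \<open>B T\<close> replaced by
  \<open>B s\<close>. The shift \<sigma> s is placed in this half, which leaves the other factor a
  function of the increment \<open>B T - B s\<close> alone.\<close>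

definition adapted_factor :: "real \<Rightarrow> real \<Rightarrow> real \<Rightarrow> real \<Rightarrow> real \<Rightarrow> 'a \<Rightarrow> real" where
  "adapted_factor \<mu> \<sigma> q \<kappa> s \<omega> =
     q * exp (\<kappa> * (B s \<omega> - \<sigma> * s)) * exp ((\<mu> - \<sigma>\<^sup>2 / 2) * s + \<sigma> * B s \<omega>)"

definition future_factor :: "real \<Rightarrow> real \<Rightarrow> real \<Rightarrow> 'a \<Rightarrow> real" where
  "future_factor T \<kappa> s \<omega> = exp (\<kappa> * (B T \<omega> - B s \<omega>))"

lemma factors_mult:
  "adapted_factor \<mu> \<sigma> q \<kappa> s \<omega> * future_factor T \<kappa> s \<omega>
     = q * exp (\<kappa> * (B T \<omega> - \<sigma> * s)) * exp ((\<mu> - \<sigma>\<^sup>2 / 2) * s + \<sigma> * B s \<omega>)"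
proof -
  have "exp (\<kappa> * (B s \<omega> - \<sigma> * s)) * exp (\<kappa> * (B T \<omega> - B s \<omega>)) = exp (\<kappa> * (B T \<omega> - \<sigma> * s))"
    by (simp add: exp_add[symmetric] algebra_simps)
  then show ?thesis by (simp add: adapted_factor_def future_factor_def ac_simps)
qed

lemma adapted_adapted_factor: "adapted_on F 0 t (adapted_factor \<mu> \<sigma> q \<kappa>)"
  unfolding adapted_on_def adapted_factor_def using B_adapted by auto

lemma continuous_adapted_factor: "continuous_process_on P 0 t (adapted_factor \<mu> \<sigma> q \<kappa>)"
  unfolding continuous_process_on_def adapted_factor_def
  using AE_continuous
proof eventually_elim
  case (elim \<omega>)
  have "continuous_on {0..t} (\<lambda>s. B s \<omega>)" using elim by (rule continuous_on_subset) auto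
  then show ?case by (intro continuous_intros)
qed

lemma continuous_future_factor: "continuous_process_on P 0 t (future_factor T \<kappa>)"
  unfolding continuous_process_on_def future_factor_def
  using AE_continuous
proof eventually_elim
  case (elim \<omega>)
  have "continuous_on {0..t} (\<lambda>s. B s \<omega>)" using elim by (rule continuous_on_subset) auto
  then show ?case by (intro continuous_intros)
qed

lemma instantly_independent_future_factor:
  assumes "t \<le> T"
  shows "instantly_independent_on P F 0 t (future_factor T \<kappa>)"
  unfolding instantly_independent_on_def
proof
  fix s assume s: "s \<in> {0..t}"
  then have s0: "0 \<le> s" "0 \<le> T" using assms by auto
  have m: "future_factor T \<kappa> s \<in> borel_measurable P"
    unfolding future_factor_def[abs_def] using B_measurable s0 by simp
  moreover have "indep_set (sets (F s)) (sigma_of P (future_factor T \<kappa> s))"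
  \<comment> \<open>Independence of increments is available only for s < T. At s = T the factor is
    the constant 1, whose preimages are empty or the whole space.\<close>
  proof (cases "s = T")
    case True
    have "sigma_of P (future_factor T \<kappa> s) \<subseteq> {{}, space P}"
      by (auto simp: sigma_of_def future_factor_def True)
    moreover have "sets (F s) \<subseteq> sets P"
      using filt s0 by (simp add: brownian_filtration_def subalgebra_def)
    ultimately show ?thesis
      by (intro indep_setI) (auto simp: prob_space dest!: subsetD[of "sigma_of _ _"] sets.sets_into_space
          simp: Int_absorb2)
  next
    case False
    have "sigma_of P (future_factor T \<kappa> s) \<subseteq> sigma_of P (\<lambda>\<omega>. B T \<omega> - B s \<omega>)"
    proof
      fix Y assume "Y \<in> sigma_of P (future_factor T \<kappa> s)"
      then obtain A where A: "A \<in> sets borel" "Y = future_factor T \<kappa> s -` A \<inter> space P"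
        by (auto simp: sigma_of_def)
      have "(\<lambda>x. exp (\<kappa> * x)) -` A \<in> sets borel"
        using measurable_sets[of "\<lambda>x::real. exp (\<kappa> * x)" borel borel A] A(1) by simp
      moreover have "Y = (\<lambda>\<omega>. B T \<omega> - B s \<omega>) -` ((\<lambda>x. exp (\<kappa> * x)) -` A) \<inter> space P"
        using A(2) by (auto simp: future_factor_def)
      ultimately show "Y \<in> sigma_of P (\<lambda>\<omega>. B T \<omega> - B s \<omega>)" unfolding sigma_of_def by blast
    qed
    moreover have "indep_set (sets (F s)) (sigma_of P (\<lambda>\<omega>. B T \<omega> - B s \<omega>))"
      using filt s0 False s assms by (simp add: brownian_filtration_def)
    ultimately show ?thesis
      unfolding indep_set_def by (elim indep_sets_mono_sets) (auto split: bool.split)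
  qed
  ultimately show "future_factor T \<kappa> s \<in> borel_measurable P \<and>
      indep_set (sets (F s)) (sigma_of P (future_factor T \<kappa> s))" ..
qed

lemma exp_product_integral:
  fixes T t \<mu> \<sigma> q \<kappa> :: real
  assumes t: "0 \<le> t" "t \<le> T" and \<sigma>: "\<sigma> > 0"
  defines "X \<equiv> \<lambda>s \<omega>. q * exp (\<kappa> * (B T \<omega> - \<sigma> * s)) * exp ((\<mu> - \<sigma>\<^sup>2 / 2) * s + \<sigma> * B s \<omega>)"
  shows "\<exists>J. has_AK_product_integral P F B 0 t (adapted_factor \<mu> \<sigma> q \<kappa>) (future_factor T \<kappa>) J \<and>
     (AE \<omega> in P. \<sigma> * J \<omega> = X t \<omega> - X 0 \<omega> - \<mu> * (LBINT s:{0..t}. X s \<omega>))"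
proof -
  \<comment> \<open>What remains of the exponent once exp(\<kappa> B T) is taken out. Then b +
    \<sigma>^2/2 + \<sigma> \<kappa> = \<mu>, so the Ito limit has exactly the drift of the stock
    equation.\<close>
  define b where "b = \<mu> - \<sigma>\<^sup>2 / 2 - \<sigma> * \<kappa>"
  define Z where "Z = (\<lambda>s \<omega>. exp (\<sigma> * B s \<omega> + b * s))"
  define A where "A = (\<lambda>\<omega>. q * exp (\<kappa> * B T \<omega>))"
  have XZ: "X s \<omega> = A \<omega> * Z s \<omega>" for s \<omega>
  proof -
    have "exp (\<kappa> * (B T \<omega> - \<sigma> * s)) * exp ((\<mu> - \<sigma>\<^sup>2 / 2) * s + \<sigma> * B s \<omega>) = exp (\<kappa> * B T \<omega>) * Z s \<omega>"
      unfolding Z_def b_def by (simp add: exp_add[symmetric] algebra_simps)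
    then show ?thesis unfolding X_def A_def by (simp add: mult.assoc)
  qed
  have T0: "0 \<le> T" using t by simp
  have mX: "X s \<in> borel_measurable P" if "0 \<le> s" for s
    unfolding X_def using B_measurable[OF that] B_measurable[OF T0] by simp
  obtain \<rho> where \<rho>: "\<And>n. is_partition 0 t (\<rho> n)" "filterlim \<rho> (mesh_to_0 0 t) sequentially"
    using ex_partition_seq[OF t(1)] by blast
  define R where "R = (\<lambda>n \<omega>. \<Sum>i<length (\<rho> n) - 1. X (\<rho> n ! i) \<omega> * (\<rho> n ! Suc i - \<rho> n ! i))"
  have mR: "R n \<in> borel_measurable P" for n
    unfolding R_def using is_partition_mem[OF \<rho>(1)] by (intro borel_measurable_sum borel_measurable_times mX) auto
  \<comment> \<open>The limit of Riemann sums is measurable, whereas the integral itself need not be: paths are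
    continuous only almost surely and \<open>P\<close> need not be complete.\<close>
  define J where "J = (\<lambda>\<omega>. (X t \<omega> - X 0 \<omega> - \<mu> * lim (\<lambda>n. R n \<omega>)) / \<sigma>)"
  have mJ: "J \<in> borel_measurable P"
    unfolding J_def using mX[OF t(1)] mX[of 0] borel_measurable_lim_metric[OF mR] by simp
  have J: "AE \<omega> in P. \<sigma> * J \<omega> = X t \<omega> - X 0 \<omega> - \<mu> * (LBINT s:{0..t}. X s \<omega>)"
    using AE_continuous
  proof eventually_elim
    case (elim \<omega>)
    have "continuous_on {0..t} (\<lambda>s. B s \<omega>)" using elim by (rule continuous_on_subset) auto
    then have "continuous_on {0..t} (\<lambda>s. X s \<omega>)" unfolding X_def by (intro continuous_intros)
    from filterlim_compose[OF riemann_sums_tendsto[OF this] \<rho>(2)]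
    have "lim (\<lambda>n. R n \<omega>) = (LBINT s:{0..t}. X s \<omega>)" unfolding R_def by (rule limI)
    then show ?case using \<sigma> by (simp add: J_def)
  qed
  let ?S = "AK_riemann_sum B (adapted_factor \<mu> \<sigma> q \<kappa>) (future_factor T \<kappa>)"
  \<comment> \<open>The future factor sits at the right endpoint. Moving it to the left one costs
    exp(-\<kappa> \<Delta>B), the damping that \<open>pathwise_ito\<close> carries; the anticipating
    \<open>A\<close> is constant along a path and leaves the sum.\<close>
  have S: "\<sigma> * ?S ts \<omega> = A \<omega> * (\<Sum>i<length ts - 1. \<sigma> * (Z (ts ! i) \<omega> *
      exp (- \<kappa> * (B (ts ! Suc i) \<omega> - B (ts ! i) \<omega>)) * (B (ts ! Suc i) \<omega> - B (ts ! i) \<omega>)))" for ts \<omega>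
  proof -
    have "adapted_factor \<mu> \<sigma> q \<kappa> u \<omega> * future_factor T \<kappa> v \<omega>
        = A \<omega> * (Z u \<omega> * exp (- \<kappa> * (B v \<omega> - B u \<omega>)))" for u v
    proof -
      have "future_factor T \<kappa> v \<omega> = future_factor T \<kappa> u \<omega> * exp (- \<kappa> * (B v \<omega> - B u \<omega>))"
        unfolding future_factor_def by (simp add: exp_add[symmetric] algebra_simps)
      then show ?thesis
        using factors_mult[of \<mu> \<sigma> q \<kappa> u \<omega> T] XZ[of u \<omega>] by (simp add: X_def mult.assoc[symmetric])
    qed
    then show ?thesis
      unfolding AK_riemann_sum_def sum_distrib_left by (intro sum.cong) (auto simp only: ac_simps)
  qed
  have "tendsto_in_prob P ?S J (mesh_to_0 0 t)"
  proof (rule tendsto_in_prob_mesh_to_0)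
    fix ts assume ts: "is_partition 0 t ts"
    have "adapted_factor \<mu> \<sigma> q \<kappa> s \<in> borel_measurable P" "future_factor T \<kappa> s \<in> borel_measurable P"
      "B s \<in> borel_measurable P" if "s \<in> {0..t}" for s
      unfolding adapted_factor_def[abs_def] future_factor_def[abs_def]
      using B_measurable[of s] B_measurable[OF T0] that by auto
    then show "?S ts \<in> borel_measurable P"
      unfolding AK_riemann_sum_def[abs_def] using is_partition_mem[OF ts]
      by (intro borel_measurable_sum borel_measurable_times borel_measurable_diff) auto
  next
    fix \<pi> :: "nat \<Rightarrow> real list"
    assume \<pi>: "\<And>n. is_partition 0 t (\<pi> n)"
      "\<And>n i. i < length (\<pi> n) - 1 \<Longrightarrow> \<pi> n ! Suc i - \<pi> n ! i < (1 / 2) ^ n"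
    have "AE \<omega> in P. (\<lambda>n. \<Sum>i<length (\<pi> n) - 1. \<sigma> * (Z (\<pi> n ! i) \<omega> *
      exp (- \<kappa> * (B (\<pi> n ! Suc i) \<omega> - B (\<pi> n ! i) \<omega>)) * (B (\<pi> n ! Suc i) \<omega> - B (\<pi> n ! i) \<omega>)))
      \<longlonglongrightarrow> Z t \<omega> - Z 0 \<omega> - (b + \<sigma>\<^sup>2 / 2 + \<sigma> * \<kappa>) * (LBINT s:{0..t}. Z s \<omega>)"
      unfolding Z_def by (intro AE_exp_ito_sums t \<pi>)
    then show "AE \<omega> in P. (\<lambda>n. ?S (\<pi> n) \<omega>) \<longlonglongrightarrow> J \<omega>"
      using J
    proof eventually_elim
      case (elim \<omega>)
      from tendsto_mult_left[OF elim(1), of "A \<omega>"]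
      have "(\<lambda>n. \<sigma> * ?S (\<pi> n) \<omega>) \<longlonglongrightarrow> A \<omega> * (Z t \<omega> - Z 0 \<omega> - \<mu> * (LBINT s:{0..t}. Z s \<omega>))"
        unfolding S by (simp add: b_def)
      also have "A \<omega> * (Z t \<omega> - Z 0 \<omega> - \<mu> * (LBINT s:{0..t}. Z s \<omega>))
          = X t \<omega> - X 0 \<omega> - \<mu> * (LBINT s:{0..t}. X s \<omega>)"
        unfolding XZ set_integral_mult_right by (simp add: algebra_simps)
      also have "\<dots> = \<sigma> * J \<omega>" by (simp add: elim(2))
      finally show ?case using \<sigma> tendsto_mult_left_iff[of \<sigma>] by simp
    qed
  qed (fact mJ)
  then have "has_AK_product_integral P F B 0 t (adapted_factor \<mu> \<sigma> q \<kappa>) (future_factor T \<kappa>) J"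
    unfolding has_AK_product_integral_def
    using adapted_adapted_factor instantly_independent_future_factor[OF t(2)] by blast
  with J show ?thesis by blast
qed

end

section \<open>Approximation of strategies\<close>

text \<open>\<open>Q\<close> is an arbitrary predicate, so its exceptional set is first enlarged to
  a Borel null set, whose affine preimage is again null. This transfers properties of f to the lines
  s \<mapsto> c - \<sigma> s.\<close>

lemma AE_lborel_affine:
  fixes a c :: real
  assumes "AE x in lborel. Q x" "c \<noteq> 0"
  shows "AE x in lborel. Q (a + c * x)"
proof -
  obtain N where N: "{x \<in> space lborel. \<not> Q x} \<subseteq> N" "emeasure lborel N = 0" "N \<in> sets lborel"
    using assms(1) by (rule AE_E)
  then have [measurable]: "N \<in> sets borel" and "N \<in> null_sets lborel" by (auto simp: null_setsI)
  then have "AE x in lborel. x \<notin> N" by (intro AE_not_in)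
  then have "AE x in lborel. a + c * x \<notin> N" using assms(2) by (intro AE_borel_affine) auto
  then show ?thesis using N(1) by (auto elim: eventually_mono)
qed

text \<open>A Lebesgue measurable function is a limit of continuous ones off a negligible set;
  clamping these to [0, 1] does not disturb the limit, since f takes its values there almost
  everywhere.\<close>

lemma strategy_continuous_approximation:
  assumes "strategy f"
  shows "\<exists>h :: nat \<Rightarrow> real \<Rightarrow> real. (\<forall>n. continuous_on UNIV (h n)) \<and> (\<forall>n x. 0 \<le> h n x \<and> h n x \<le> 1) \<and>
    (AE x in lborel. (\<lambda>n. h n x) \<longlonglongrightarrow> f x)"
proof -
  have f: "f \<in> borel_measurable borel" "AE x in lborel. 0 \<le> f x \<and> f x \<le> 1"
    using assms by (auto simp: strategy_def)
  have "f \<in> borel_measurable lebesgue" using f(1) by (simp add: measurable_completion)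
  then have "f measurable_on UNIV" by (rule lebesgue_measurable_imp_measurable_on_real) simp
  then obtain N g where N: "negligible N" and g: "\<And>n. continuous_on UNIV (g n)"
    "\<And>x. x \<notin> N \<Longrightarrow> (\<lambda>n. g n x) \<longlonglongrightarrow> f x"
    unfolding measurable_on_def by auto
  have "AE x in lebesgue. x \<notin> N" using N by (intro AE_not_in) (simp add: negligible_iff_null_sets)
  then have "AE x in lborel. x \<notin> N" by (simp add: AE_completion_iff)
  with f(2) have "AE x in lborel. (\<lambda>n. max 0 (min 1 (g n x))) \<longlonglongrightarrow> f x"
  proof eventually_elim
    case (elim x)
    have "(\<lambda>n. max 0 (min 1 (g n x))) \<longlonglongrightarrow> max 0 (min 1 (f x))"
      by (intro tendsto_intros g elim(2))
    then show ?case using elim(1) by simp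
  qed
  moreover have "continuous_on UNIV (\<lambda>x. max 0 (min 1 (g n x)))" for n
    by (intro continuous_intros g)
  ultimately show ?thesis by (intro exI[of _ "\<lambda>n x. max 0 (min 1 (g n x))"]) auto
qed

text \<open>A product \<open>exp (\<kappa> * (B T - B s)) * exp (\<kappa> * B s)\<close> separates the future from the past, so
  polynomials in \<open>exp x\<close> give admissible approximations of \<open>f (B T - \<sigma> * s)\<close>. They converge and are
  bounded only locally, which suffices because each path stays in a compact set.\<close>

lemma strategy_exp_polynomial_approximation:
  assumes "strategy f"
  shows "\<exists>(c :: nat \<Rightarrow> nat \<Rightarrow> real) d. (AE x in lborel. (\<lambda>n. \<Sum>i\<le>d n. c n i * exp (real i * x)) \<longlonglongrightarrow> f x) \<and>
     (\<forall>n x. \<bar>x\<bar> \<le> real n \<longrightarrow> \<bar>\<Sum>i\<le>d n. c n i * exp (real i * x)\<bar> \<le> 2)"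
proof -
  obtain h :: "nat \<Rightarrow> real \<Rightarrow> real" where h: "\<And>n. continuous_on UNIV (h n)"
    "\<And>n x. 0 \<le> h n x \<and> h n x \<le> 1" "AE x in lborel. (\<lambda>n. h n x) \<longlonglongrightarrow> f x"
    using strategy_continuous_approximation[OF assms] by blast
  \<comment> \<open>Stone-Weierstrass in the variable y = exp x. The window [-n, n] becomes a
    compact interval away from 0, where ln is continuous, and the monomial y^i becomes exp(i
    x).\<close>
  have "\<exists>c d. \<forall>x. \<bar>x\<bar> \<le> real n \<longrightarrow> \<bar>h n x - (\<Sum>i\<le>d. c i * exp (real i * x))\<bar> < 1 / Suc n" for n
  proof -
    have "continuous_on {exp (- real n)..exp n} (\<lambda>y. h n (ln y))"
      by (rule continuous_on_compose2[OF h(1)[of n]]) (auto intro!: continuous_intros)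
    then obtain p where p: "real_polynomial_function p"
      "\<And>y. y \<in> {exp (- real n)..exp n} \<Longrightarrow> \<bar>h n (ln y) - p y\<bar> < 1 / Suc n"
      using Stone_Weierstrass_real_polynomial_function[of "{exp (- real n)..exp n}" "\<lambda>y. h n (ln y)" "1 / Suc n"]
      by auto
    obtain c d where cd: "p = (\<lambda>y. \<Sum>i\<le>d. c i * y ^ i)"
      using p(1) real_polynomial_function_iff_sum by auto
    have "\<bar>h n x - (\<Sum>i\<le>d. c i * exp (real i * x))\<bar> < 1 / Suc n" if "\<bar>x\<bar> \<le> real n" for x :: real
      using p(2)[of "exp x"] that by (simp add: cd exp_of_nat_mult abs_le_iff)
    then show ?thesis by blast
  qed
  then obtain c d where cd: "\<And>n x. \<bar>x\<bar> \<le> real n \<Longrightarrow>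
      \<bar>h n x - (\<Sum>i\<le>d n. c n i * exp (real i * x))\<bar> < 1 / Suc n" by metis
  have "AE x in lborel. (\<lambda>n. \<Sum>i\<le>d n. c n i * exp (real i * x)) \<longlonglongrightarrow> f x"
    using h(3)
  proof eventually_elim
    case (elim x)
    obtain m :: nat where m: "\<bar>x\<bar> \<le> m" using real_arch_simple by blast
    have "(\<lambda>n. h n x - (\<Sum>i\<le>d n. c n i * exp (real i * x))) \<longlonglongrightarrow> 0"
    proof (rule Lim_null_comparison[OF _ LIMSEQ_inverse_real_of_nat])
      show "eventually (\<lambda>n. norm (h n x - (\<Sum>i\<le>d n. c n i * exp (real i * x))) \<le> inverse (real (Suc n))) sequentially"
        using eventually_ge_at_top[of m]
      proof eventually_elim
        case (elim n)
        then have "\<bar>x\<bar> \<le> real n" using m by linarith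
        then show ?case using cd[of x n] by (simp add: inverse_eq_divide)
      qed
    qed
    from tendsto_diff[OF elim this] show ?case by simp
  qed
  moreover have "\<bar>\<Sum>i\<le>d n. c n i * exp (real i * x)\<bar> \<le> 2" if "\<bar>x\<bar> \<le> real n" for n x
  proof -
    have "1 / real (Suc n) \<le> 1" by simp
    then show ?thesis using cd[OF that] h(2)[of n x] by linarith
  qed
  ultimately show ?thesis by blast
qed

text \<open>Everything needed about a single path, with c the value of \<open>B T\<close> and e the
  exponential factor. Because \<sigma> \<noteq> 0, almost everywhere statements about f hold along s
  \<mapsto> c - \<sigma> s for every c, so no exceptional set of paths arises from f.\<close>

lemma path_approximation:
  fixes e f :: "real \<Rightarrow> real" and q :: "nat \<Rightarrow> real \<Rightarrow> real"
  assumes e: "continuous_on {0..t} e" and f: "strategy f" and \<sigma>: "\<sigma> \<noteq> 0"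
    and q: "\<And>n. continuous_on UNIV (q n)" "AE x in lborel. (\<lambda>n. q n x) \<longlonglongrightarrow> f x"
      "\<And>n x. \<bar>x\<bar> \<le> real n \<Longrightarrow> \<bar>q n x\<bar> \<le> 2"
  shows "set_integrable lborel {0..t} (\<lambda>s. f (c - \<sigma> * s) * e s)"
    and "set_integrable lborel {0..t} (\<lambda>s. \<bar>f (c - \<sigma> * s) * e s - q n (c - \<sigma> * s) * e s\<bar>\<^sup>2)"
    and "(\<lambda>n. LBINT s:{0..t}. \<bar>f (c - \<sigma> * s) * e s - q n (c - \<sigma> * s) * e s\<bar>\<^sup>2) \<longlonglongrightarrow> 0"
    and "(\<lambda>n. LBINT s:{0..t}. q n (c - \<sigma> * s) * e s) \<longlonglongrightarrow> (LBINT s:{0..t}. f (c - \<sigma> * s) * e s)"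
proof -
  \<comment> \<open>Extension by zero turns integrals over [0, t] into integrals over the line and
    makes the factor Borel from its continuity on [0, t] alone.\<close>
  define E where "E = (\<lambda>s. indicator {0..t} s * e s)"
  have [measurable]: "E \<in> borel_measurable borel"
    unfolding E_def using borel_measurable_continuous_on_indicator[OF _ e] by simp
  have [measurable]: "f \<in> borel_measurable borel" using f by (simp add: strategy_def)
  have [measurable]: "q n \<in> borel_measurable borel" for n
    by (rule borel_measurable_continuous_onI[OF q(1)])
  have fb: "AE s in lborel. 0 \<le> f (c - \<sigma> * s) \<and> f (c - \<sigma> * s) \<le> 1"
    using AE_lborel_affine[of "\<lambda>x. 0 \<le> f x \<and> f x \<le> 1" "- \<sigma>" c] f \<sigma> by (simp add: strategy_def)
  have ql: "AE s in lborel. (\<lambda>n. q n (c - \<sigma> * s)) \<longlonglongrightarrow> f (c - \<sigma> * s)"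
    using AE_lborel_affine[of "\<lambda>x. (\<lambda>n. q n x) \<longlonglongrightarrow> f x" "- \<sigma>" c] q(2) \<sigma> by simp
  have bnd: "\<exists>K>0. \<forall>s\<in>{0..t}. \<bar>u s\<bar> \<le> K" if "continuous_on {0..t} u" for u :: "real \<Rightarrow> real"
  proof -
    have "bounded (u ` {0..t})"
      using compact_continuous_image[OF that] compact_imp_bounded by blast
    then show ?thesis unfolding bounded_pos by auto
  qed
  obtain C where C: "C > 0" "\<And>s. s \<in> {0..t} \<Longrightarrow> \<bar>e s\<bar> \<le> C" using bnd[OF e] by auto
  have EC: "\<bar>E s\<bar> \<le> C * indicator {0..t} s" for s using C by (auto simp: E_def indicator_def)
  have iC: "integrable lborel (\<lambda>s. K * indicator {0..t} s :: real)" for K :: real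
    by (intro integrable_mult_right integrable_real_indicator) (auto simp: emeasure_lborel_Icc_eq)
  have ind: "(\<lambda>s. indicator {0..t} s *\<^sub>R (g s * e s)) = (\<lambda>s. g s * E s)" for g :: "real \<Rightarrow> real"
    by (simp add: E_def fun_eq_iff)
  have ind2: "(\<lambda>s. indicator {0..t} s *\<^sub>R (\<bar>g s * e s - k s * e s\<bar>\<^sup>2)) = (\<lambda>s. (g s * E s - k s * E s)\<^sup>2)"
    for g k :: "real \<Rightarrow> real"
    by (auto simp: E_def indicator_def fun_eq_iff)
  have if1: "integrable lborel (\<lambda>s. f (c - \<sigma> * s) * E s)"
  proof (rule Bochner_Integration.integrable_bound[OF iC[of C]])
    show "AE s in lborel. norm (f (c - \<sigma> * s) * E s) \<le> norm (C * indicator {0..t} s)"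
      using fb
    proof eventually_elim
      case (elim s)
      have "\<bar>f (c - \<sigma> * s)\<bar> * \<bar>E s\<bar> \<le> 1 * (C * indicator {0..t} s)"
        using elim EC[of s] by (intro mult_mono) auto
      then show ?case using C by (simp add: abs_mult)
    qed
  qed measurable
  then show "set_integrable lborel {0..t} (\<lambda>s. f (c - \<sigma> * s) * e s)"
    by (simp only: set_integrable_def ind)
  \<comment> \<open>Serves twice: with K depending on n for the integrability of each single term,
    and with K = 2 as the common majorant of the tail.\<close>
  have bound2: "AE s in lborel. norm ((f (c - \<sigma> * s) * E s - q n (c - \<sigma> * s) * E s)\<^sup>2) \<le> ((1 + K) * C)\<^sup>2 * indicator {0..t} s"
    if K: "\<And>s. s \<in> {0..t} \<Longrightarrow> \<bar>q n (c - \<sigma> * s)\<bar> \<le> K" for n K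
    using fb
  proof eventually_elim
    case (elim s)
    show ?case
    proof (cases "s \<in> {0..t}")
      case True
      have "\<bar>f (c - \<sigma> * s) - q n (c - \<sigma> * s)\<bar> \<le> 1 + K" using elim K[OF True] by linarith
      moreover have "\<bar>E s\<bar> \<le> C" using EC[of s] True by simp
      ultimately have "\<bar>(f (c - \<sigma> * s) - q n (c - \<sigma> * s)) * E s\<bar> \<le> (1 + K) * C"
        unfolding abs_mult by (intro mult_mono) auto
      then have "\<bar>(f (c - \<sigma> * s) - q n (c - \<sigma> * s)) * E s\<bar>\<^sup>2 \<le> ((1 + K) * C)\<^sup>2"
        by (intro power_mono) auto
      then show ?thesis using True by (simp add: left_diff_distrib)
    qed (simp add: E_def)
  qed
  show "set_integrable lborel {0..t} (\<lambda>s. \<bar>f (c - \<sigma> * s) * e s - q n (c - \<sigma> * s) * e s\<bar>\<^sup>2)"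
  proof -
    have "continuous_on {0..t} (\<lambda>s. q n (c - \<sigma> * s))"
      by (rule continuous_on_compose2[OF q(1)[of n]]) (auto intro!: continuous_intros)
    then obtain K where K: "\<And>s. s \<in> {0..t} \<Longrightarrow> \<bar>q n (c - \<sigma> * s)\<bar> \<le> K" using bnd by blast
    have "integrable lborel (\<lambda>s. (f (c - \<sigma> * s) * E s - q n (c - \<sigma> * s) * E s)\<^sup>2)"
      by (rule Bochner_Integration.integrable_bound[OF iC[of "((1 + K) * C)\<^sup>2"]])
        (use bound2[of n K, OF K] in \<open>auto elim: eventually_mono\<close>)
    then show ?thesis by (simp only: set_integrable_def ind2)
  qed
  \<comment> \<open>On [0, t] the argument c - \<sigma> s stays in [-m, m], so the bound 2 holds
    from index m on. Dominated convergence is applied to this tail and the offset removed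
    afterwards.\<close>
  obtain m :: nat where m: "\<bar>c\<bar> + \<bar>\<sigma>\<bar> * \<bar>t\<bar> \<le> m" using real_arch_simple by blast
  have qb: "\<bar>q (n + m) (c - \<sigma> * s)\<bar> \<le> 2" if "s \<in> {0..t}" for s n
  proof (rule q(3))
    have "\<bar>c - \<sigma> * s\<bar> \<le> \<bar>c\<bar> + \<bar>\<sigma>\<bar> * \<bar>s\<bar>" by (metis abs_mult abs_triangle_ineq4)
    also have "\<dots> \<le> \<bar>c\<bar> + \<bar>\<sigma>\<bar> * \<bar>t\<bar>" using that by (intro add_left_mono mult_left_mono) auto
    also have "\<dots> \<le> real (n + m)" using m by simp
    finally show "\<bar>c - \<sigma> * s\<bar> \<le> real (n + m)" .
  qed
  have "(\<lambda>n. LINT s|lborel. (f (c - \<sigma> * s) * E s - q (n + m) (c - \<sigma> * s) * E s)\<^sup>2) \<longlonglongrightarrow> (LINT s|(lborel :: real measure). 0)"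
  proof (rule integral_dominated_convergence[where w = "\<lambda>s. ((1 + 2) * C)\<^sup>2 * indicator {0..t} s"])
    show "integrable lborel (\<lambda>s. ((1 + 2) * C)\<^sup>2 * indicator {0..t} s :: real)" by (rule iC)
    show "AE s in lborel. (\<lambda>n. (f (c - \<sigma> * s) * E s - q (n + m) (c - \<sigma> * s) * E s)\<^sup>2) \<longlonglongrightarrow> 0"
      using ql
    proof eventually_elim
      case (elim s)
      from LIMSEQ_ignore_initial_segment[OF elim, of m]
      have "(\<lambda>n. (f (c - \<sigma> * s) * E s - q (n + m) (c - \<sigma> * s) * E s)\<^sup>2)
          \<longlonglongrightarrow> (f (c - \<sigma> * s) * E s - f (c - \<sigma> * s) * E s)\<^sup>2"
        by (intro tendsto_intros)
      then show ?case by simp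
    qed
    show "AE s in lborel. norm ((f (c - \<sigma> * s) * E s - q (n + m) (c - \<sigma> * s) * E s)\<^sup>2)
        \<le> ((1 + 2) * C)\<^sup>2 * indicator {0..t} s" for n
      by (rule bound2) (rule qb)
  qed measurable
  then have "(\<lambda>n. LINT s|lborel. (f (c - \<sigma> * s) * E s - q n (c - \<sigma> * s) * E s)\<^sup>2) \<longlonglongrightarrow> 0"
    unfolding integral_zero by (rule LIMSEQ_offset)
  then show "(\<lambda>n. LBINT s:{0..t}. \<bar>f (c - \<sigma> * s) * e s - q n (c - \<sigma> * s) * e s\<bar>\<^sup>2) \<longlonglongrightarrow> 0"
    by (simp only: set_lebesgue_integral_def ind2)
  have "(\<lambda>n. LINT s|lborel. q (n + m) (c - \<sigma> * s) * E s) \<longlonglongrightarrow> (LINT s|lborel. f (c - \<sigma> * s) * E s)"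
  proof (rule integral_dominated_convergence[where w = "\<lambda>s. 2 * C * indicator {0..t} s"])
    show "integrable lborel (\<lambda>s. 2 * C * indicator {0..t} s :: real)" by (rule iC)
    show "AE s in lborel. (\<lambda>n. q (n + m) (c - \<sigma> * s) * E s) \<longlonglongrightarrow> f (c - \<sigma> * s) * E s"
      using ql
    proof eventually_elim
      case (elim s)
      from LIMSEQ_ignore_initial_segment[OF elim, of m] show ?case by (intro tendsto_intros)
    qed
    show "AE s in lborel. norm (q (n + m) (c - \<sigma> * s) * E s) \<le> 2 * C * indicator {0..t} s" for n
    proof (rule AE_I2)
      fix s :: real
      show "norm (q (n + m) (c - \<sigma> * s) * E s) \<le> 2 * C * indicator {0..t} s"
      proof (cases "s \<in> {0..t}")
        case True
        then have "\<bar>q (n + m) (c - \<sigma> * s)\<bar> * \<bar>E s\<bar> \<le> 2 * C"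
          using qb[OF True] EC[of s] by (intro mult_mono) auto
        then show ?thesis using True by (simp add: abs_mult)
      qed (simp add: E_def)
    qed
  qed measurable
  then show "(\<lambda>n. LBINT s:{0..t}. q n (c - \<sigma> * s) * e s) \<longlonglongrightarrow> (LBINT s:{0..t}. f (c - \<sigma> * s) * e s)"
    unfolding set_lebesgue_integral_def ind by (rule LIMSEQ_offset)
qed

section \<open>The market\<close>

text \<open>The integrating factor exp(-\<rho> s) makes the derivative vanish, so every pathwise
  solution has the same terminal value.\<close>

lemma bank_solution_terminal:
  assumes "bank_solution P B T M \<rho> f X" "T > 0" "\<omega> \<in> space P"
  shows "X T \<omega> = M * (1 - f (B T \<omega>)) * exp (\<rho> * T)"
proof -
  have X: "X 0 \<omega> = M * (1 - f (B T \<omega>))"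
    "\<And>t. t \<in> {0..T} \<Longrightarrow> ((\<lambda>s. X s \<omega>) has_real_derivative \<rho> * X t \<omega>) (at t within {0..T})"
    using assms by (auto simp: bank_solution_def)
  have "((\<lambda>s. X s \<omega> * exp (- \<rho> * s)) has_real_derivative 0) (at t within {0..T})" if "t \<in> {0..T}" for t
    by (rule derivative_eq_intros X(2)[OF that] refl)+ simp
  then have "\<exists>c. \<forall>t\<in>{0..T}. X t \<omega> * exp (- \<rho> * t) = c"
    by (intro has_field_derivative_zero_constant) auto
  then obtain c where "\<forall>t\<in>{0..T}. X t \<omega> * exp (- \<rho> * t) = c" ..
  then have "X T \<omega> * exp (- \<rho> * T) = c" "X 0 \<omega> * exp (- \<rho> * 0) = c"
    using assms(2) by (metis atLeastAtMost_iff less_imp_le order_refl)+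
  then have "X T \<omega> * exp (- \<rho> * T) = X 0 \<omega> * exp (- \<rho> * 0)" by simp
  then have "X T \<omega> * (exp (- \<rho> * T) * exp (\<rho> * T)) = X 0 \<omega> * exp (\<rho> * T)"
    by (simp only: mult.assoc[symmetric]) simp
  then show ?thesis by (simp add: X(1) exp_add[symmetric])
qed

text \<open>Completing the square: exponential tilting of a Gaussian is a translation, up to the
  normalising constant.\<close>

lemma normal_density_shift:
  fixes T :: real
  assumes "T > 0"
  shows "normal_density 0 (sqrt T) x * exp (\<sigma> * x) = exp (\<sigma>\<^sup>2 * T / 2) * normal_density 0 (sqrt T) (x - \<sigma> * T)"
proof -
  have "- x\<^sup>2 / (2 * T) + \<sigma> * x = \<sigma>\<^sup>2 * T / 2 + - (x - \<sigma> * T)\<^sup>2 / (2 * T)"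
    using assms by (simp add: field_simps power2_eq_square)
  then have "exp (- x\<^sup>2 / (2 * T)) * exp (\<sigma> * x) = exp (\<sigma>\<^sup>2 * T / 2) * exp (- (x - \<sigma> * T)\<^sup>2 / (2 * T))"
    by (simp only: exp_add[symmetric])
  then show ?thesis using assms by (simp add: normal_density_def)
qed

section \<open>Law of the terminal value and expected wealth\<close>

context brownian_setting
begin

lemma B_distributed:
  assumes "T > 0"
  shows "distributed P lborel (B T) (normal_density 0 (sqrt T))"
proof -
  have d: "distributed P lborel (\<lambda>\<omega>. B T \<omega> - B 0 \<omega>) (normal_density 0 (sqrt T))"
    using increment_distributed[of 0 T] assms by simp
  have "AE \<omega> in P. B T \<omega> - B 0 \<omega> = B T \<omega>"
    using bm by (auto simp: standard_brownian_motion_def elim: eventually_mono)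
  then have "distr P lborel (\<lambda>\<omega>. B T \<omega> - B 0 \<omega>) = distr P lborel (B T)"
    using B_measurable[of T] B_measurable[of 0] assms by (intro distr_cong_AE) auto
  with d show ?thesis
    using B_measurable[of T] assms by (simp add: distributed_def)
qed

text \<open>The Gaussian density is strictly positive, so the law of \<open>B T\<close> and Lebesgue
  measure have the same null sets. Hence almost sure equality of f(B T) with 1 is the same as
  equality of f with 1 in the sense of classes.\<close>

lemma AE_B_iff:
  assumes T: "T > 0" and [measurable]: "Measurable.pred borel Q"
  shows "(AE \<omega> in P. Q (B T \<omega>)) \<longleftrightarrow> (AE x in lborel. Q x)"
proof -
  have "(AE \<omega> in P. Q (B T \<omega>)) \<longleftrightarrow> (AE x in distr P lborel (B T). Q x)"
    using B_measurable[of T] T by (subst AE_distr_iff) auto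
  also have "\<dots> \<longleftrightarrow> (AE x in lborel. 0 < ennreal (normal_density 0 (sqrt T) x) \<longrightarrow> Q x)"
    unfolding distributed_distr_eq_density[OF B_distributed[OF T], symmetric]
    by (subst distributed_distr_eq_density[OF B_distributed[OF T]], subst AE_density) auto
  also have "\<dots> \<longleftrightarrow> (AE x in lborel. Q x)" using T by (simp add: normal_density_pos)
  finally show ?thesis .
qed

lemma AE_B_imp:
  assumes T: "T > 0" and Q: "AE x in lborel. Q x"
  shows "AE \<omega> in P. Q (B T \<omega>)"
proof -
  obtain N where N: "{x \<in> space lborel. \<not> Q x} \<subseteq> N" "emeasure lborel N = 0" "N \<in> sets lborel"
    using Q by (rule AE_E)
  then have [measurable]: "N \<in> sets borel" and "N \<in> null_sets lborel" by (auto simp: null_setsI)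
  then have "AE x in lborel. x \<notin> N" by (intro AE_not_in)
  then have "AE \<omega> in P. B T \<omega> \<notin> N" using AE_B_iff[OF T, of "\<lambda>x. x \<notin> N"] by simp
  then show ?thesis using N(1) by (auto elim: eventually_mono)
qed

text \<open>A Girsanov shift: the weight turns the law of \<open>B T - \<sigma> * T\<close> back into that of \<open>B T\<close>.\<close>

lemma stock_expectation:
  assumes T: "T > 0" and f: "strategy f"
  shows "integrable P (AK_stock B T M \<mu> \<sigma> f T)"
    and "expectation (AK_stock B T M \<mu> \<sigma> f T) = M * exp (\<mu> * T) * expectation (\<lambda>\<omega>. f (B T \<omega>))"
    and "integrable P (\<lambda>\<omega>. f (B T \<omega>))"
proof -
  let ?nd = "normal_density 0 (sqrt T)"
  have [measurable]: "f \<in> borel_measurable borel" using f by (simp add: strategy_def)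
  note [measurable] = B_measurable[OF less_imp_le[OF T]]
  note d = B_distributed[OF T]
  have nd: "0 \<le> ?nd x" for x using T by simp
  have "AE \<omega> in P. 0 \<le> f (B T \<omega>) \<and> f (B T \<omega>) \<le> 1"
    using f by (intro AE_B_imp[OF T]) (simp add: strategy_def)
  then show if1: "integrable P (\<lambda>\<omega>. f (B T \<omega>))"
    by (intro integrable_const_bound[where B = 1]) (auto elim: eventually_mono)
  then have il: "integrable lborel (\<lambda>x. ?nd x * f x)"
    using distributed_integrable[OF d, of f] nd by simp
  define g where "g = (\<lambda>x. M * f (x - \<sigma> * T) * exp ((\<mu> - \<sigma>\<^sup>2 / 2) * T + \<sigma> * x))"
  have S: "AK_stock B T M \<mu> \<sigma> f T = (\<lambda>\<omega>. g (B T \<omega>))" by (simp add: AK_stock_def g_def fun_eq_iff)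
  have [measurable]: "g \<in> borel_measurable borel" unfolding g_def by measurable
  define u where "u = (\<lambda>x. M * exp (\<mu> * T) * (?nd x * f x))"
  have shift: "?nd x * g x = u (- \<sigma> * T + 1 * x)" for x
  proof -
    have "?nd x * g x = M * f (x - \<sigma> * T) * exp ((\<mu> - \<sigma>\<^sup>2 / 2) * T) * (?nd x * exp (\<sigma> * x))"
      by (simp add: g_def exp_add)
    also have "\<dots> = M * (exp ((\<mu> - \<sigma>\<^sup>2 / 2) * T) * exp (\<sigma>\<^sup>2 * T / 2)) * (?nd (x - \<sigma> * T) * f (x - \<sigma> * T))"
      unfolding normal_density_shift[OF T] by simp
    \<comment> \<open>The Ito correction -\<sigma>^2/2 cancels the normalising constant of the tilt;
      what remains is a pure translation, which Lebesgue measure ignores.\<close>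
    also have "exp ((\<mu> - \<sigma>\<^sup>2 / 2) * T) * exp (\<sigma>\<^sup>2 * T / 2) = exp (\<mu> * T)"
      by (simp add: exp_add[symmetric] algebra_simps)
    finally show ?thesis by (simp add: u_def)
  qed
  have iu: "integrable lborel u" unfolding u_def using il by simp
  have "integrable lborel (\<lambda>x. ?nd x * g x)"
    unfolding shift using iu by (rule lborel_integrable_real_affine) simp
  then show "integrable P (AK_stock B T M \<mu> \<sigma> f T)"
    unfolding S using distributed_integrable[OF d, of g] nd by simp
  have "expectation (AK_stock B T M \<mu> \<sigma> f T) = (LINT x|lborel. u (- \<sigma> * T + 1 * x))"
    unfolding S shift[symmetric] using distributed_integral[OF d, of g] nd by simp
  also have "\<dots> = (LINT x|lborel. u x)"
    using lborel_integral_real_affine[of 1 u "- \<sigma> * T"] by simp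
  also have "\<dots> = M * exp (\<mu> * T) * expectation (\<lambda>\<omega>. f (B T \<omega>))"
    unfolding u_def using distributed_integral[OF d, of f] nd by simp
  finally show "expectation (AK_stock B T M \<mu> \<sigma> f T) = M * exp (\<mu> * T) * expectation (\<lambda>\<omega>. f (B T \<omega>))" .
qed

text \<open>Since 1 - f(B T) is almost surely nonnegative, its mean vanishes only if it does so
  almost surely; positivity of the Gaussian density carries this over to Lebesgue measure.\<close>

lemma expectation_strategy_le_1:
  assumes T: "T > 0" and f: "strategy f"
  shows "expectation (\<lambda>\<omega>. f (B T \<omega>)) \<le> 1"
    and "expectation (\<lambda>\<omega>. f (B T \<omega>)) = 1 \<longleftrightarrow> (AE x in lborel. f x = 1)"
proof -
  have [measurable]: "f \<in> borel_measurable borel" using f by (simp add: strategy_def)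
  have le: "AE \<omega> in P. f (B T \<omega>) \<le> 1"
    using f by (intro AE_B_imp[OF T]) (auto simp: strategy_def elim: eventually_mono)
  have i: "integrable P (\<lambda>\<omega>. 1 - f (B T \<omega>))"
    using stock_expectation(3)[OF T f] by simp
  have e: "expectation (\<lambda>\<omega>. 1 - f (B T \<omega>)) = 1 - expectation (\<lambda>\<omega>. f (B T \<omega>))"
    using stock_expectation(3)[OF T f] by (simp add: prob_space)
  have nn: "AE \<omega> in P. 0 \<le> 1 - f (B T \<omega>)" using le by (auto elim: eventually_mono)
  show "expectation (\<lambda>\<omega>. f (B T \<omega>)) \<le> 1" using integral_nonneg_AE[OF nn] e by simp
  have "expectation (\<lambda>\<omega>. f (B T \<omega>)) = 1 \<longleftrightarrow> (AE \<omega> in P. 1 - f (B T \<omega>) = 0)"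
    using integral_nonneg_eq_0_iff_AE[OF i nn] e by auto
  also have "\<dots> \<longleftrightarrow> (AE \<omega> in P. f (B T \<omega>) = 1)" by (rule AE_cong) auto
  also have "\<dots> \<longleftrightarrow> (AE x in lborel. f x = 1)" by (rule AE_B_iff[OF T]) simp
  finally show "expectation (\<lambda>\<omega>. f (B T \<omega>)) = 1 \<longleftrightarrow> (AE x in lborel. f x = 1)" .
qed

text \<open>Formulated for any \<open>S1\<close> that agrees with \<open>AK_stock\<close> at time T
  almost surely, so that it covers both the explicit solution and an unspecified unique one.
  Measurability is a separate premise because almost sure equality does not transfer it when
  \<open>P\<close> is not complete.\<close>

lemma optimal_strategy_iff:
  assumes T: "T > 0" and M: "M > 0" and \<mu>: "\<mu> > \<rho>"
    and S0: "\<And>f. strategy f \<Longrightarrow> bank_solution P B T M \<rho> f (S0 f)"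
    and S1: "\<And>f. strategy f \<Longrightarrow> S1 f T \<in> borel_measurable P"
      "\<And>f. strategy f \<Longrightarrow> AE \<omega> in P. S1 f T \<omega> = AK_stock B T M \<mu> \<sigma> f T \<omega>"
    and f: "strategy f"
  shows "optimal_strategy P (\<lambda>h \<omega>. S0 h T \<omega> + S1 h T \<omega>) f \<longleftrightarrow> (AE x in lborel. f x = 1)"
proof -
  let ?E = "\<lambda>h. expectation (\<lambda>\<omega>. h (B T \<omega>))"
  let ?W = "\<lambda>h \<omega>. S0 h T \<omega> + S1 h T \<omega>"
  have W: "integrable P (?W h)"
    "expectation (?W h) = M * exp (\<rho> * T) + M * (exp (\<mu> * T) - exp (\<rho> * T)) * ?E h"
    if h: "strategy h" for h
  proof -
    let ?V = "\<lambda>\<omega>. M * exp (\<rho> * T) * (1 - h (B T \<omega>)) + AK_stock B T M \<mu> \<sigma> h T \<omega>"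
    note st = stock_expectation(1,2)[OF T h, where M = M and \<mu> = \<mu> and \<sigma> = \<sigma>] and hi = stock_expectation(3)[OF T h]
    have iV: "integrable P ?V" using st(1) hi by simp
    have "S0 h T \<omega> = M * exp (\<rho> * T) * (1 - h (B T \<omega>))" if "\<omega> \<in> space P" for \<omega>
      using bank_solution_terminal[OF S0[OF h] T that] by simp
    then have S0': "AE \<omega> in P. S0 h T \<omega> = M * exp (\<rho> * T) * (1 - h (B T \<omega>))" by (intro AE_I2)
    have eq: "AE \<omega> in P. ?W h \<omega> = ?V \<omega>" using S0' S1(2)[OF h] by eventually_elim simp
    have "S0 h T \<in> borel_measurable P"
    proof (subst measurable_cong)
      show "\<omega> \<in> space P \<Longrightarrow> S0 h T \<omega> = M * exp (\<rho> * T) * (1 - h (B T \<omega>))" for \<omega>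
        using bank_solution_terminal[OF S0[OF h] T] by simp
      show "(\<lambda>\<omega>. M * exp (\<rho> * T) * (1 - h (B T \<omega>))) \<in> borel_measurable P" using hi by measurable
    qed
    then have mW: "?W h \<in> borel_measurable P" using S1(1)[OF h] by simp
    show "integrable P (?W h)"
      using integrable_cong_AE[OF mW borel_measurable_integrable[OF iV] eq] iV by simp
    have "expectation (?W h) = expectation ?V"
      by (rule integral_cong_AE[OF mW borel_measurable_integrable[OF iV] eq])
    also have "\<dots> = M * exp (\<rho> * T) * (1 - ?E h) + M * exp (\<mu> * T) * ?E h"
      using st hi by (simp add: prob_space)
    finally show "expectation (?W h) = M * exp (\<rho> * T) + M * (exp (\<mu> * T) - exp (\<rho> * T)) * ?E h"
      by (simp add: algebra_simps)
  qed
  have "exp (\<rho> * T) < exp (\<mu> * T)" using T \<mu> by simp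
  then have pos: "M * (exp (\<mu> * T) - exp (\<rho> * T)) > 0" using M by simp
  have le: "expectation (?W h) \<le> expectation (?W k) \<longleftrightarrow> ?E h \<le> ?E k" if "strategy h" "strategy k" for h k
    unfolding W(2)[OF that(1)] W(2)[OF that(2)] using mult_le_cancel_left_pos[OF pos] by simp
  \<comment> \<open>The constant strategy is the competitor that any optimum has to match; it is
    what makes the condition necessary.\<close>
  have one: "strategy (\<lambda>_. 1)" by (simp add: strategy_def)
  have "optimal_strategy P ?W f \<longleftrightarrow> ?E f = 1"
  proof
    assume "optimal_strategy P ?W f"
    then have "1 \<le> ?E f" using one le[OF one f] by (simp add: optimal_strategy_def prob_space)
    then show "?E f = 1" using expectation_strategy_le_1(1)[OF T f] by simp
  next
    assume "?E f = 1"
    then show "optimal_strategy P ?W f"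
      unfolding optimal_strategy_def using f W(1) le[OF _ f] expectation_strategy_le_1(1)[OF T] by auto
  qed
  then show ?thesis using expectation_strategy_le_1(2)[OF T f] by simp
qed

section \<open>The closed form solves the stock equation\<close>

definition exp_product_sum :: "real \<Rightarrow> real \<Rightarrow> real \<Rightarrow> (real \<times> real) list \<Rightarrow> 'a product_sum" where
  "exp_product_sum T \<mu> \<sigma> qs = map (\<lambda>(q, \<kappa>). (adapted_factor \<mu> \<sigma> q \<kappa>, future_factor T \<kappa>)) qs"

lemma product_sum_process_Cons:
  "product_sum_process (exp_product_sum T \<mu> \<sigma> ((q, \<kappa>) # qs)) s \<omega> =
     q * exp (\<kappa> * (B T \<omega> - \<sigma> * s)) * exp ((\<mu> - \<sigma>\<^sup>2 / 2) * s + \<sigma> * B s \<omega>)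
     + product_sum_process (exp_product_sum T \<mu> \<sigma> qs) s \<omega>"
  by (simp add: exp_product_sum_def product_sum_process_def factors_mult)

lemma product_sum_process_exp_polynomial:
  "product_sum_process (exp_product_sum T \<mu> \<sigma> (map (\<lambda>i. (M * c i, real i)) [0..<Suc d])) s \<omega> =
     (\<Sum>i\<le>d. c i * exp (real i * (B T \<omega> - \<sigma> * s))) * (M * exp ((\<mu> - \<sigma>\<^sup>2 / 2) * s + \<sigma> * B s \<omega>))"
proof -
  have "product_sum_process (exp_product_sum T \<mu> \<sigma> (map (\<lambda>i. (M * c i, real i)) [0..<Suc d])) s \<omega>
      = (\<Sum>i\<leftarrow>[0..<Suc d]. c i * exp (real i * (B T \<omega> - \<sigma> * s)) * (M * exp ((\<mu> - \<sigma>\<^sup>2 / 2) * s + \<sigma> * B s \<omega>)))"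
    unfolding product_sum_process_def exp_product_sum_def
    by (simp add: comp_def factors_mult del: upt_Suc) (simp only: ac_simps)
  also have "\<dots> = (\<Sum>i\<in>{0..<Suc d}. c i * exp (real i * (B T \<omega> - \<sigma> * s)) * (M * exp ((\<mu> - \<sigma>\<^sup>2 / 2) * s + \<sigma> * B s \<omega>)))"
    by (simp only: interv_sum_list_conv_sum_set_nat atLeast_upt set_upt)
  finally show ?thesis
    by (simp only: sum_distrib_right atLeast0LessThan lessThan_Suc_atMost)
qed

lemma admissible_exp_product_sum:
  "t \<le> T \<Longrightarrow> admissible_product_sum P F 0 t (exp_product_sum T \<mu> \<sigma> qs)"
  unfolding admissible_product_sum_def exp_product_sum_def
  using adapted_adapted_factor continuous_adapted_factor instantly_independent_future_factor
    continuous_future_factor by auto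

lemma continuous_exp_product_sum:
  assumes "continuous_on {0..t} (\<lambda>s. B s \<omega>)"
  shows "continuous_on {0..t} (\<lambda>s. product_sum_process (exp_product_sum T \<mu> \<sigma> qs) s \<omega>)"
proof (induction qs)
  case Nil
  then show ?case by (simp add: exp_product_sum_def product_sum_process_def)
next
  case (Cons p qs)
  obtain q \<kappa> where p: "p = (q, \<kappa>)" by (cases p)
  show ?case unfolding p product_sum_process_Cons using Cons assms by (intro continuous_intros)
qed

text \<open>The sum integral and the equation are both linear, so one exponential is added at a
  time; almost sure continuity of the paths justifies splitting the time integral.\<close>

lemma exp_product_sum_integral:
  assumes t: "0 \<le> t" "t \<le> T" and \<sigma>: "\<sigma> > 0"
  shows "\<exists>J. J \<in> borel_measurable P \<and> has_AK_sum_integral P F B 0 t (exp_product_sum T \<mu> \<sigma> qs) J \<and>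
    (AE \<omega> in P. \<sigma> * J \<omega> = product_sum_process (exp_product_sum T \<mu> \<sigma> qs) t \<omega>
       - product_sum_process (exp_product_sum T \<mu> \<sigma> qs) 0 \<omega>
       - \<mu> * (LBINT s:{0..t}. product_sum_process (exp_product_sum T \<mu> \<sigma> qs) s \<omega>))"
proof (induction qs)
  case Nil
  show ?case
    by (intro exI[of _ "\<lambda>_. 0"])
      (auto simp: exp_product_sum_def product_sum_process_def has_AK_sum_integral_def intro: exI[of _ "[]"])
next
  case (Cons p qs)
  obtain q \<kappa> where p: "p = (q, \<kappa>)" by (cases p)
  let ?X = "\<lambda>s \<omega>. q * exp (\<kappa> * (B T \<omega> - \<sigma> * s)) * exp ((\<mu> - \<sigma>\<^sup>2 / 2) * s + \<sigma> * B s \<omega>)"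
  let ?Y = "\<lambda>s \<omega>. product_sum_process (exp_product_sum T \<mu> \<sigma> qs) s \<omega>"
  obtain J where J: "J \<in> borel_measurable P" "has_AK_sum_integral P F B 0 t (exp_product_sum T \<mu> \<sigma> qs) J"
    "AE \<omega> in P. \<sigma> * J \<omega> = ?Y t \<omega> - ?Y 0 \<omega> - \<mu> * (LBINT s:{0..t}. ?Y s \<omega>)"
    using Cons.IH by blast
  obtain J' where J': "has_AK_product_integral P F B 0 t (adapted_factor \<mu> \<sigma> q \<kappa>) (future_factor T \<kappa>) J'"
    "AE \<omega> in P. \<sigma> * J' \<omega> = ?X t \<omega> - ?X 0 \<omega> - \<mu> * (LBINT s:{0..t}. ?X s \<omega>)"
    using exp_product_integral[OF t \<sigma>] by blast
  show ?case
  proof (intro exI conjI)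
    show "(\<lambda>\<omega>. J' \<omega> + J \<omega>) \<in> borel_measurable P"
      using J(1) J'(1) unfolding has_AK_product_integral_def tendsto_in_prob_def
      by (intro borel_measurable_add) auto
    obtain Is where Is: "list_all2 (\<lambda>(g, \<phi>) J. has_AK_product_integral P F B 0 t g \<phi> J) (exp_product_sum T \<mu> \<sigma> qs) Is"
      "J = (\<lambda>\<omega>. \<Sum>J\<leftarrow>Is. J \<omega>)" using J(2) by (auto simp: has_AK_sum_integral_def)
    show "has_AK_sum_integral P F B 0 t (exp_product_sum T \<mu> \<sigma> (p # qs)) (\<lambda>\<omega>. J' \<omega> + J \<omega>)"
      unfolding has_AK_sum_integral_def
      by (rule exI[of _ "J' # Is"]) (use Is J'(1) in \<open>simp add: p exp_product_sum_def\<close>)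
    show "AE \<omega> in P. \<sigma> * (J' \<omega> + J \<omega>) = product_sum_process (exp_product_sum T \<mu> \<sigma> (p # qs)) t \<omega>
       - product_sum_process (exp_product_sum T \<mu> \<sigma> (p # qs)) 0 \<omega>
       - \<mu> * (LBINT s:{0..t}. product_sum_process (exp_product_sum T \<mu> \<sigma> (p # qs)) s \<omega>)"
      using J(3) J'(2) AE_continuous
    proof eventually_elim
      case (elim \<omega>)
      have cont: "continuous_on {0..t} (\<lambda>s. B s \<omega>)" using elim(3) by (rule continuous_on_subset) auto
      have "continuous_on {0..t} (\<lambda>s. ?X s \<omega>)" using cont by (intro continuous_intros)
      from borel_integrable_atLeastAtMost'[OF this]
        borel_integrable_atLeastAtMost'[OF continuous_exp_product_sum[OF cont]]
      have "(LBINT s:{0..t}. ?X s \<omega> + ?Y s \<omega>) = (LBINT s:{0..t}. ?X s \<omega>) + (LBINT s:{0..t}. ?Y s \<omega>)"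
        by (rule set_integral_add(2))
      then show ?case
        unfolding p product_sum_process_Cons using elim(1,2) by (simp add: distrib_left)
    qed
  qed
qed

lemma AK_stock_is_solution:
  assumes T: "T > 0" and \<sigma>: "\<sigma> > 0" and f: "strategy f"
  shows "AK_stock_solution P F B T M \<mu> \<sigma> f (AK_stock B T M \<mu> \<sigma> f)"
proof -
  let ?X = "AK_stock B T M \<mu> \<sigma> f"
  have [measurable]: "f \<in> borel_measurable borel" using f by (simp add: strategy_def)
  have mX: "?X s \<in> borel_measurable P" if "0 \<le> s" for s
    unfolding AK_stock_def[abs_def] using B_measurable[OF that] B_measurable[of T] T by simp
  define e where "e = (\<lambda>\<omega> s. M * exp ((\<mu> - \<sigma>\<^sup>2 / 2) * s + \<sigma> * B s \<omega>))"
  have X: "?X s \<omega> = f (B T \<omega> - \<sigma> * s) * e \<omega> s" for s \<omega> by (simp add: AK_stock_def e_def)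
  have cont: "AE \<omega> in P. \<forall>t. continuous_on {0..t} (\<lambda>s. B s \<omega>)"
    using AE_continuous by eventually_elim (auto intro: continuous_on_subset)
  have ce: "continuous_on {0..t} (e \<omega>)" if "continuous_on {0..t} (\<lambda>s. B s \<omega>)" for t \<omega>
    unfolding e_def using that by (intro continuous_intros)
  obtain c d where cd: "AE x in lborel. (\<lambda>n. \<Sum>i\<le>d n. c n i * exp (real i * x)) \<longlonglongrightarrow> f x"
    "\<And>n x. \<bar>x\<bar> \<le> real n \<Longrightarrow> \<bar>\<Sum>i\<le>d n. c n i * exp (real i * x)\<bar> \<le> (2::real)"
    using strategy_exp_polynomial_approximation[OF f] by blast
  define q where "q = (\<lambda>n x. \<Sum>i\<le>d n. c n i * exp (real i * x))"
  have q: "\<And>n. continuous_on UNIV (q n)" "AE x in lborel. (\<lambda>n. q n x) \<longlonglongrightarrow> f x"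
    "\<And>n x. \<bar>x\<bar> \<le> real n \<Longrightarrow> \<bar>q n x\<bar> \<le> 2"
    using cd by (auto simp: q_def intro!: continuous_intros)
  \<comment> \<open>\<open>M\<close> goes into the coefficients because \<open>e\<close> contains
    it, while \<open>q n\<close> approximates f itself.\<close>
  define ps where "ps = (\<lambda>n. exp_product_sum T \<mu> \<sigma> (map (\<lambda>i. (M * c n i, real i)) [0..<Suc (d n)]))"
  have ps: "product_sum_process (ps n) s \<omega> = q n (B T \<omega> - \<sigma> * s) * e \<omega> s" for n s \<omega>
    unfolding ps_def product_sum_process_exp_polynomial q_def e_def ..
  have \<sigma>0: "\<sigma> \<noteq> 0" using \<sigma> by simp
  note path = path_approximation[OF ce f \<sigma>0 q]
  \<comment> \<open>Convergence at a fixed time passes through the law of \<open>B T\<close>. The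
    null set depends on s, which is harmless as only s = 0 and s = t are evaluated; the times
    between enter through the path integrals.\<close>
  have point: "AE \<omega> in P. (\<lambda>n. product_sum_process (ps n) s \<omega>) \<longlonglongrightarrow> ?X s \<omega>" for s
  proof -
    have "AE x in lborel. (\<lambda>n. q n (- \<sigma> * s + 1 * x)) \<longlonglongrightarrow> f (- \<sigma> * s + 1 * x)"
      by (rule AE_lborel_affine[OF q(2)]) simp
    from AE_B_imp[OF T this] show ?thesis
    proof eventually_elim
      case (elim \<omega>)
      then show ?case unfolding ps X by (intro tendsto_mult_right) (simp add: algebra_simps)
    qed
  qed
  have X0: "AE \<omega> in P. ?X 0 \<omega> = M * f (B T \<omega>)"
  proof -
    have "AE \<omega> in P. B 0 \<omega> = 0" using bm by (simp add: standard_brownian_motion_def)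
    then show ?thesis by eventually_elim (simp add: AK_stock_def)
  qed
  have integral: "\<exists>I. has_AK_integral P F B 0 t ?X I \<and>
      (AE \<omega> in P. ?X t \<omega> = ?X 0 \<omega> + \<mu> * (LBINT s:{0..t}. ?X s \<omega>) + \<sigma> * I \<omega>)"
    if t: "t \<in> {0..T}" for t
  proof -
    have t': "0 \<le> t" "t \<le> T" using t by auto
    have "\<forall>n. \<exists>J. J \<in> borel_measurable P \<and> has_AK_sum_integral P F B 0 t (ps n) J \<and>
      (AE \<omega> in P. \<sigma> * J \<omega> = product_sum_process (ps n) t \<omega> - product_sum_process (ps n) 0 \<omega>
       - \<mu> * (LBINT s:{0..t}. product_sum_process (ps n) s \<omega>))"
      unfolding ps_def using exp_product_sum_integral[OF t' \<sigma>] by blast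
    then obtain J where J: "\<And>n. J n \<in> borel_measurable P" "\<And>n. has_AK_sum_integral P F B 0 t (ps n) (J n)"
      "\<And>n. AE \<omega> in P. \<sigma> * J n \<omega> = product_sum_process (ps n) t \<omega> - product_sum_process (ps n) 0 \<omega>
       - \<mu> * (LBINT s:{0..t}. product_sum_process (ps n) s \<omega>)"
      using choice[of "\<lambda>n J. J \<in> borel_measurable P \<and> has_AK_sum_integral P F B 0 t (ps n) J \<and>
      (AE \<omega> in P. \<sigma> * J \<omega> = product_sum_process (ps n) t \<omega> - product_sum_process (ps n) 0 \<omega>
       - \<mu> * (LBINT s:{0..t}. product_sum_process (ps n) s \<omega>))"] by blast
    \<comment> \<open>A limit of measurable variables is measurable outright; the equation then
      identifies it almost surely, although its time integral may fail to be measurable in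
      \<omega>.\<close>
    define I where "I = (\<lambda>\<omega>. lim (\<lambda>n. J n \<omega>))"
    have mI: "I \<in> borel_measurable P" unfolding I_def by (rule borel_measurable_lim_metric[OF J(1)])
    have J': "AE \<omega> in P. \<forall>n. \<sigma> * J n \<omega> = product_sum_process (ps n) t \<omega> - product_sum_process (ps n) 0 \<omega>
       - \<mu> * (LBINT s:{0..t}. product_sum_process (ps n) s \<omega>)"
      unfolding AE_all_countable using J(3) by blast
    have lim: "AE \<omega> in P. (\<lambda>n. J n \<omega>) \<longlonglongrightarrow> I \<omega> \<and>
        ?X t \<omega> = ?X 0 \<omega> + \<mu> * (LBINT s:{0..t}. ?X s \<omega>) + \<sigma> * I \<omega>"
      using J' cont point[of t] point[of 0]
    proof eventually_elim
      case (elim \<omega>)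
      let ?L = "?X t \<omega> - ?X 0 \<omega> - \<mu> * (LBINT s:{0..t}. ?X s \<omega>)"
      have "(\<lambda>n. LBINT s:{0..t}. product_sum_process (ps n) s \<omega>) \<longlonglongrightarrow> (LBINT s:{0..t}. ?X s \<omega>)"
        unfolding ps X by (rule path(4)) (use elim(2) in blast)
      then have "(\<lambda>n. \<sigma> * J n \<omega>) \<longlonglongrightarrow> ?L"
        unfolding spec[OF elim(1)] by (intro tendsto_intros elim(3,4))
      then have "(\<lambda>n. \<sigma> * J n \<omega> / \<sigma>) \<longlonglongrightarrow> ?L / \<sigma>" by (intro tendsto_divide tendsto_const \<sigma>0)
      then have *: "(\<lambda>n. J n \<omega>) \<longlonglongrightarrow> ?L / \<sigma>" using \<sigma>0 by simp
      then have "I \<omega> = ?L / \<sigma>" unfolding I_def by (rule limI)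
      with * show ?case using \<sigma>0 by simp
    qed
    have "has_AK_integral P F B 0 t ?X I"
      unfolding has_AK_integral_def
    proof (intro conjI exI allI ballI)
      show "s \<in> {0..t} \<Longrightarrow> ?X s \<in> borel_measurable P" for s using mX by simp
      show "AE \<omega> in P. set_borel_measurable borel {0..t} (\<lambda>s. ?X s \<omega>)"
        using cont
      proof eventually_elim
        case (elim \<omega>)
        have "set_integrable lborel {0..t} (\<lambda>s. ?X s \<omega>)"
          unfolding X by (rule path(1)) (use elim in blast)
        then show ?case
          unfolding set_integrable_def set_borel_measurable_def by (auto dest: borel_measurable_integrable)
      qed
      show "admissible_product_sum P F 0 t (ps n)" for n
        unfolding ps_def by (rule admissible_exp_product_sum[OF t'(2)])
      show "has_AK_sum_integral P F B 0 t (ps n) (J n)" for n by (rule J(2))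
      show "AE \<omega> in P. (\<forall>n. set_integrable lborel {0..t} (\<lambda>s. \<bar>?X s \<omega> - product_sum_process (ps n) s \<omega>\<bar>\<^sup>2)) \<and>
          (\<lambda>n. LBINT s:{0..t}. \<bar>?X s \<omega> - product_sum_process (ps n) s \<omega>\<bar>\<^sup>2) \<longlonglongrightarrow> 0"
        using cont
      proof eventually_elim
        case (elim \<omega>)
        then have c: "continuous_on {0..t} (\<lambda>s. B s \<omega>)" by blast
        show ?case unfolding ps X using path(2)[OF c] path(3)[OF c] by blast
      qed
      show "tendsto_in_prob P J I sequentially"
        using lim by (intro AE_tendsto_imp_tendsto_in_prob J(1) mI) (auto elim: eventually_mono)
    qed
    moreover have "AE \<omega> in P. ?X t \<omega> = ?X 0 \<omega> + \<mu> * (LBINT s:{0..t}. ?X s \<omega>) + \<sigma> * I \<omega>"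
      using lim by (auto elim: eventually_mono)
    ultimately show ?thesis by blast
  qed
  have "AE \<omega> in P. set_integrable lborel {0..T} (\<lambda>s. ?X s \<omega>)"
    using cont unfolding X by eventually_elim (auto intro: path(1))
  with mX X0 integral show ?thesis unfolding AK_stock_solution_def by auto
qed

end

theorem theorem4p7:
  fixes P :: "'a measure" and F :: "real \<Rightarrow> 'a measure" and B :: "real \<Rightarrow> 'a \<Rightarrow> real"
    and T M \<rho> \<mu> \<sigma> :: real
    and S\<^sub>0 :: "(real \<Rightarrow> real) \<Rightarrow> real \<Rightarrow> 'a \<Rightarrow> real"
  assumes "standard_brownian_motion P B"
    and "brownian_filtration P F B"
    and "T > 0" "M > 0" "\<rho> > 0" "\<mu> > 0" "\<sigma> > 0" "\<mu> > \<rho>"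
    and "\<And>f. strategy f \<Longrightarrow> bank_solution P B T M \<rho> f (S\<^sub>0 f)"
  shows "(\<forall>S\<^sub>1 :: (real \<Rightarrow> real) \<Rightarrow> real \<Rightarrow> 'a \<Rightarrow> real.
            (\<forall>f. strategy f \<longrightarrow> unique_AK_stock_solution P F B T M \<mu> \<sigma> f (S\<^sub>1 f)) \<longrightarrow>
            (\<forall>f. strategy f \<longrightarrow>
               (optimal_strategy P (\<lambda>h \<omega>. S\<^sub>0 h T \<omega> + S\<^sub>1 h T \<omega>) f \<longleftrightarrow> (AE x in lborel. f x = 1))))
       \<and> (\<forall>f. strategy f \<longrightarrow> AK_stock_solution P F B T M \<mu> \<sigma> f (AK_stock B T M \<mu> \<sigma> f))
       \<and> (\<forall>f. strategy f \<longrightarrow>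
            (optimal_strategy P (\<lambda>h \<omega>. S\<^sub>0 h T \<omega> + AK_stock B T M \<mu> \<sigma> h T \<omega>) f \<longleftrightarrow>
               (AE x in lborel. f x = 1)))"
proof -
  interpret prob_space P using assms(1) by (simp add: standard_brownian_motion_def)
  interpret brownian_setting P F B by unfold_locales fact+
  note stock = AK_stock_is_solution[OF \<open>T > 0\<close> \<open>\<sigma> > 0\<close>]
  note optimal = optimal_strategy_iff[OF \<open>T > 0\<close> \<open>M > 0\<close> \<open>\<mu> > \<rho>\<close> assms(9)]
  have T: "T \<in> {0..T}" using \<open>T > 0\<close> by simp
  show ?thesis
  proof (intro conjI allI impI)
    fix f assume f: "strategy f"
    show "AK_stock_solution P F B T M \<mu> \<sigma> f (AK_stock B T M \<mu> \<sigma> f)" by (rule stock[OF f])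
    show "optimal_strategy P (\<lambda>h \<omega>. S\<^sub>0 h T \<omega> + AK_stock B T M \<mu> \<sigma> h T \<omega>) f \<longleftrightarrow> (AE x in lborel. f x = 1)"
      by (rule optimal[OF _ _ _ f]) (use stock T in \<open>auto simp: AK_stock_solution_def\<close>)
  next
    fix S\<^sub>1 :: "(real \<Rightarrow> real) \<Rightarrow> real \<Rightarrow> 'a \<Rightarrow> real" and f
    assume S1: "\<forall>f. strategy f \<longrightarrow> unique_AK_stock_solution P F B T M \<mu> \<sigma> f (S\<^sub>1 f)" and f: "strategy f"
    show "optimal_strategy P (\<lambda>h \<omega>. S\<^sub>0 h T \<omega> + S\<^sub>1 h T \<omega>) f \<longleftrightarrow> (AE x in lborel. f x = 1)"
    proof (rule optimal[OF _ _ _ f])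
      fix h assume h: "strategy h"
      then have "unique_AK_stock_solution P F B T M \<mu> \<sigma> h (S\<^sub>1 h)" using S1 by blast
      \<comment> \<open>The explicit process is a solution, so assumed uniqueness identifies it with
        \<open>S\<^sub>1 h\<close>; this is where the uniqueness enters.\<close>
      then have sol: "AK_stock_solution P F B T M \<mu> \<sigma> h (S\<^sub>1 h)"
        and uniq: "\<forall>t\<in>{0..T}. AE \<omega> in P. AK_stock B T M \<mu> \<sigma> h t \<omega> = S\<^sub>1 h t \<omega>"
        using stock[OF h] unfolding unique_AK_stock_solution_def by blast+
      show "S\<^sub>1 h T \<in> borel_measurable P" using sol T unfolding AK_stock_solution_def by blast
      show "AE \<omega> in P. S\<^sub>1 h T \<omega> = AK_stock B T M \<mu> \<sigma> h T \<omega>"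
        using bspec[OF uniq T] by (auto elim: eventually_mono)
    qed
  qed
qed

end
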